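(* Let $0<q\le1$ and let $(f_k)_{k\ge1}$ be a sequence in $L_{2,q}(0,1)$ such that $f_k^*\le f^*$ for all $k$, where $f\in L_{2,q}(0,1)$. Put $H_n=\sum_{k=1}^n\frac1k$. Then, as $n\to\infty$, $$\left\|\left(\sum_{k=1}^n\frac{|f_k|^2}{k}\right)^{1/2}\right\|_{2,q}=o\bigl(H_n^{1/q}\bigr).$$ Consequently, for every fixed $r>\max\{2,q\}$, $$\left(\operatorname{Ave}_{\varepsilon_k=\pm1}\left\|\sum_{k=1}^n\frac{\varepsilon_k f_k}{\sqrt{k}}\right\|_{2,q}^{r}\right)^{1/r}=o\bigl(H_n^{1/q}\bigr).$$
   Context: For a measurable scalar function $f$ on $(0,1)$ with Lebesgue measure $m$, $f^*(t)=\inf\{\lambda>0:m\{|f|>\lambda\}\le t\}$, $t>0$, is its decreasing rearrangement. For $0<q<\infty$, $L_{2,q}(0,1)$ is the space of measurable $f$ on $(0,1)$ with $\|f\|_{2,q}=\left(\int_0^\infty [t^{1/2}f^*(t)]^q\,\frac{dt}{t}\right)^{1/q}<\infty$. $\operatorname{Ave}_{\varepsilon_k=\pm1}$ denotes the arithmetic mean over all $2^n$ choices of signs $(\varepsilon_1,\dots,\varepsilon_n)\in\{-1,1\}^n$. *)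

theory Defs
  imports "HOL-Analysis.Analysis" "HOL-Library.Landau_Symbols"
begin

text \<open>Functions on \<open>(0,1)\<close> are total functions on the reals; only their values on the open
  unit interval matter.\<close>

abbreviation unit_leb :: "real measure"
  where "unit_leb \<equiv> lebesgue_on {0<..<1}"

text \<open>Only meant for measurable \<open>f\<close> and \<open>t > 0\<close>: then the set below is nonempty and bounded
  below by 0, so the infimum is the true one.\<close>

definition decr_rearr :: "(real \<Rightarrow> 'a::real_normed_vector) \<Rightarrow> real \<Rightarrow> real"
  where "decr_rearr f t =
    Inf {s. s > 0 \<and> measure unit_leb {x \<in> {0<..<1}. norm (f x) > s} \<le> t}"

definition lorentz2_integral :: "real \<Rightarrow> (real \<Rightarrow> 'a::real_normed_vector) \<Rightarrow> ennreal"
  where "lorentz2_integral q f =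
    (\<integral>\<^sup>+t\<in>{0<..}. ennreal ((t powr (1/2) * decr_rearr f t) powr q / t) \<partial>lborel)"

definition lorentz2 :: "real \<Rightarrow> (real \<Rightarrow> 'a::real_normed_vector) set"
  where "lorentz2 q = {f \<in> borel_measurable unit_leb. lorentz2_integral q f < \<infinity>}"

text \<open>Meaningful only on \<open>lorentz2 q\<close>, since \<open>enn2real\<close> sends \<open>\<infinity>\<close> to 0.\<close>

definition lorentz2_norm :: "real \<Rightarrow> (real \<Rightarrow> 'a::real_normed_vector) \<Rightarrow> real"
  where "lorentz2_norm q f = enn2real (lorentz2_integral q f) powr (1/q)"

definition signs :: "nat \<Rightarrow> (nat \<Rightarrow> real) set"
  where "signs n = {1..n} \<rightarrow>\<^sub>E {-1, 1}"

definition Ave :: "nat \<Rightarrow> ((nat \<Rightarrow> real) \<Rightarrow> real) \<Rightarrow> real"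
  where "Ave n F = (\<Sum>\<epsilon>\<in>signs n. F \<epsilon>) / 2 ^ n"

definition square_fun :: "(nat \<Rightarrow> real \<Rightarrow> 'a::real_normed_vector) \<Rightarrow> nat \<Rightarrow> real \<Rightarrow> real"
  where "square_fun f n x = sqrt (\<Sum>k=1..n. (norm (f k x))\<^sup>2 / real k)"

definition signed_sum ::
    "(nat \<Rightarrow> real \<Rightarrow> 'a::real_normed_vector) \<Rightarrow> nat \<Rightarrow> (nat \<Rightarrow> real) \<Rightarrow> real \<Rightarrow> 'a"
  where "signed_sum f n \<epsilon> x = (\<Sum>k=1..n. (\<epsilon> k / sqrt (real k)) *\<^sub>R f k x)"

end

theory Submission imports Defs
begin

text \<open>Put \<open>p = q/2\<close>. Up to the factor \<open>2/q\<close>, the \<open>q\<close>-th power of the norm of \<open>g\<close> is the Choquet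
  integral \<open>\<integral>\<^sub>0\<^sup>\<infinity> m{\<bar>g\<bar>\<^sup>q > s}\<^sup>p ds\<close>, which is countably subadditive in \<open>\<bar>g\<bar>\<^sup>q\<close> because \<open>p < 1\<close>.
  Cutting each \<open>\<bar>f\<^sub>k\<bar>\<^sup>q\<close> at the levels \<open>2\<^sup>i\<close>, \<open>i \<ge> L\<close>, reduces the square function to the bounded
  part, which contributes only \<open>2\<^sup>L H\<^sub>n\<^sup>p = o(H\<^sub>n)\<close>, and to sums \<open>\<Sum> 1\<^bsub>A(k)\<^esub>/k\<close> with
  \<open>m(A(k)) \<le> m{\<bar>f\<bar>\<^sup>q > 2\<^sup>i}\<close>. Each of these contributes at most \<open>8 H\<^sub>n 2\<^sup>i m{\<bar>f\<bar>\<^sup>q > 2\<^sup>i}\<^sup>p\<close>, and the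
  sum over \<open>i \<ge> L\<close> is \<open>H\<^sub>n\<close> times the tail of a convergent series.

  For the signed sums \<open>X\<^sub>\<epsilon>\<close> write \<open>\<bar>X\<^sub>\<epsilon>\<bar>\<^sup>q = S\<^sup>q W\<^sub>\<epsilon>\<^sup>q\<close> with the square function \<open>S\<close>. Cutting \<open>S\<^sup>q\<close>
  at dyadic levels yields a weight \<open>\<psi>\<close>, of integral at most \<open>1\<close> plus a multiple of the
  \<open>q\<close>-th power of the norm of \<open>S\<close>, such that the
  Choquet integral of \<open>\<bar>X\<^sub>\<epsilon>\<bar>\<^sup>q\<close> is at most \<open>\<integral> (2 + W\<^sub>\<epsilon>\<^sup>4) \<psi>\<close>. Jensen's inequality and the pointwise
  subgaussian bound for \<open>W\<^sub>\<epsilon>\<close> then control all moments over the signs.\<close>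

section \<open>Integrals of powers over initial and final segments\<close>

lemma nn_integral_powr_from_0:
  fixes a c :: real
  assumes "0 < a" "0 \<le> c"
  shows "(\<integral>\<^sup>+t. ennreal (t powr (a - 1)) * indicator {0<..<c} t \<partial>lborel) = ennreal (c powr a / a)"
proof -
  have "((\<lambda>t. t powr (a - 1)) has_integral c powr a / a) {0..c}"
    using has_integral_powr_from_0[of "a - 1" c] assms by simp
  then have "(\<integral>\<^sup>+t. ennreal (indicator {0..c} t *\<^sub>R t powr (a - 1)) \<partial>lborel) = ennreal (c powr a / a)"
    using nn_integral_has_integral_lebesgue[of "{0..c}" "\<lambda>t. t powr (a - 1)"]
    by (simp add: mult.commute)
  also have "(\<integral>\<^sup>+t. ennreal (indicator {0..c} t *\<^sub>R t powr (a - 1)) \<partial>lborel)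
      = (\<integral>\<^sup>+t. ennreal (t powr (a - 1)) * indicator {0<..<c} t \<partial>lborel)"
  proof (rule nn_integral_cong_AE)
    have "AE t in lborel. t \<noteq> 0 \<and> t \<noteq> c"
      using AE_lborel_singleton[of 0] AE_lborel_singleton[of c] by (auto)
    then show "AE t in lborel. ennreal (indicator {0..c} t *\<^sub>R t powr (a - 1))
        = ennreal (t powr (a - 1)) * indicator {0<..<c} t"
      by eventually_elim (auto split: split_indicator)
  qed
  finally show ?thesis .
qed

lemma nn_integral_powr_to_inf:
  fixes a c :: real
  assumes "0 < a" "0 < c"
  shows "(\<integral>\<^sup>+t. ennreal (t powr (- a - 1)) * indicator {c<..} t \<partial>lborel) = ennreal (c powr (- a) / a)"
proof -
  have "((\<lambda>t. t powr (- a - 1)) has_integral c powr (- a) / a) {c..}"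
    using has_integral_powr_to_inf[of "- a - 1" c] assms by simp
  then have "(\<integral>\<^sup>+t. ennreal (indicator {c..} t *\<^sub>R t powr (- a - 1)) \<partial>lborel) = ennreal (c powr (- a) / a)"
    using nn_integral_has_integral_lebesgue[of "{c..}" "\<lambda>t. t powr (- a - 1)"]
    by (simp add: mult.commute)
  also have "(\<integral>\<^sup>+t. ennreal (indicator {c..} t *\<^sub>R t powr (- a - 1)) \<partial>lborel)
      = (\<integral>\<^sup>+t. ennreal (t powr (- a - 1)) * indicator {c<..} t \<partial>lborel)"
  proof (rule nn_integral_cong_AE)
    show "AE t in lborel. ennreal (indicator {c..} t *\<^sub>R t powr (- a - 1))
        = ennreal (t powr (- a - 1)) * indicator {c<..} t"
      using AE_lborel_singleton[of c] by eventually_elim (auto split: split_indicator)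
  qed
  finally show ?thesis .
qed

lemma emeasure_lborel_greaterThan: "emeasure lborel {c::real<..} = \<infinity>"
proof -
  have "ennreal (real n) \<le> emeasure lborel {c<..}" for n
  proof -
    have "ennreal (real n) = emeasure lborel {c<..<c + real n}" by simp
    also have "\<dots> \<le> emeasure lborel {c<..}" by (rule emeasure_mono) auto
    finally show ?thesis .
  qed
  then have "\<not> (\<exists>n. emeasure lborel {c<..} < of_nat n)"
    by (simp add: ennreal_of_nat_eq_real_of_nat not_less)
  then show ?thesis
    using ennreal_Ex_less_of_nat[of "emeasure lborel {c<..}"] by (auto simp: less_top[symmetric])
qed

section \<open>Distribution functions and countable subadditivity of the Choquet integral\<close>

definition dist_fun :: "'a measure \<Rightarrow> ('a \<Rightarrow> ennreal) \<Rightarrow> real \<Rightarrow> real"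
  where "dist_fun M v s = measure M {x \<in> space M. ennreal s < v x}"

text \<open>This is the Choquet integral of \<open>v\<close> for the capacity m(A)^p. Extended
  values of \<open>v\<close> let infinite series serve as majorants. Levels are restricted to s > 0
  because \<open>ennreal\<close> sends every negative level to 0.\<close>

definition choquet :: "real \<Rightarrow> 'a measure \<Rightarrow> ('a \<Rightarrow> ennreal) \<Rightarrow> ennreal"
  where "choquet p M v = (\<integral>\<^sup>+s\<in>{0<..}. ennreal (dist_fun M v s powr p) \<partial>lborel)"

text \<open>For r > 0 this is the integral of the decreasing rearrangement of \<open>v\<close> over
  (0,r), that is, the K-functional of the couple (L_1, L_infinity) at r.\<close>

definition trunc_integral :: "'a measure \<Rightarrow> real \<Rightarrow> ('a \<Rightarrow> ennreal) \<Rightarrow> ennreal"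
  where "trunc_integral M r v = (\<integral>\<^sup>+s\<in>{0<..}. ennreal (min r (dist_fun M v s)) \<partial>lborel)"

context finite_measure
begin

lemma dist_fun_nonneg [simp]: "0 \<le> dist_fun M v s"
  by (simp add: dist_fun_def)

lemma dist_fun_antimono:
  assumes [measurable]: "v \<in> borel_measurable M" and "s \<le> t"
  shows "dist_fun M v t \<le> dist_fun M v s"
  unfolding dist_fun_def
  by (rule finite_measure_mono) (use assms(2) in \<open>auto dest: le_less_trans[OF ennreal_leI]\<close>)

lemma dist_fun_measurable [measurable]:
  assumes "v \<in> borel_measurable M"
  shows "dist_fun M v \<in> borel_measurable borel"
proof -
  have "(\<lambda>s. - dist_fun M v s) \<in> borel_measurable borel"
    by (rule borel_measurable_mono) (simp add: mono_def dist_fun_antimono assms)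
  then show ?thesis by simp
qed

text \<open>Tonelli's theorem for the region below the graph of \<open>v\<close>. The weight
  \<open>h\<close> stays general: it is later the indicator of a half-line and also a power of
  s.\<close>

lemma layer_cake:
  assumes [measurable]: "v \<in> borel_measurable M" "h \<in> borel_measurable borel"
  shows "(\<integral>\<^sup>+s. h s * ennreal (dist_fun M v s) \<partial>lborel)
    = (\<integral>\<^sup>+x. (\<integral>\<^sup>+s. h s * indicator {s. ennreal s < v x} s \<partial>lborel) \<partial>M)"
proof -
  interpret pair_sigma_finite M lborel ..
  have "(\<integral>\<^sup>+s. h s * ennreal (dist_fun M v s) \<partial>lborel)
      = (\<integral>\<^sup>+s. (\<integral>\<^sup>+x. h s * indicator {s. ennreal s < v x} s \<partial>M) \<partial>lborel)"
  proof (rule nn_integral_cong)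
    fix s
    have "ennreal (dist_fun M v s) = (\<integral>\<^sup>+x. indicator {x \<in> space M. ennreal s < v x} x \<partial>M)"
      by (simp add: dist_fun_def emeasure_eq_measure)
    also have "\<dots> = (\<integral>\<^sup>+x. indicator {s. ennreal s < v x} s \<partial>M)"
      by (rule nn_integral_cong) (auto split: split_indicator)
    finally have "h s * ennreal (dist_fun M v s) = h s * (\<integral>\<^sup>+x. indicator {s. ennreal s < v x} s \<partial>M)"
      by simp
    also have "\<dots> = (\<integral>\<^sup>+x. h s * indicator {s. ennreal s < v x} s \<partial>M)"
      by (rule nn_integral_cmult[symmetric]) (simp add: indicator_def)
    finally show "h s * ennreal (dist_fun M v s)
        = (\<integral>\<^sup>+x. h s * indicator {s. ennreal s < v x} s \<partial>M)" .
  qed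
  also have "\<dots> = (\<integral>\<^sup>+x. (\<integral>\<^sup>+s. h s * indicator {s. ennreal s < v x} s \<partial>lborel) \<partial>M)"
    unfolding indicator_def by (rule Fubini') measurable
  finally show ?thesis .
qed

text \<open>Subtraction in \<open>ennreal\<close> is truncated, so \<open>v x - ennreal c\<close> is
  the positive part of v - c, which is the length of the set of levels between c and
  \<open>v x\<close>.\<close>

lemma layer_cake_above:
  assumes [measurable]: "v \<in> borel_measurable M" and "0 \<le> c"
  shows "(\<integral>\<^sup>+s\<in>{c<..}. ennreal (dist_fun M v s) \<partial>lborel) = (\<integral>\<^sup>+x. v x - ennreal c \<partial>M)"
proof -
  have "(\<integral>\<^sup>+s\<in>{c<..}. ennreal (dist_fun M v s) \<partial>lborel)
      = (\<integral>\<^sup>+s. indicator {c<..} s * ennreal (dist_fun M v s) \<partial>lborel)"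
    by (simp add: mult.commute)
  also have "\<dots> = (\<integral>\<^sup>+x. (\<integral>\<^sup>+s. indicator {c<..} s * indicator {s. ennreal s < v x} s \<partial>lborel) \<partial>M)"
    by (rule layer_cake) auto
  also have "\<dots> = (\<integral>\<^sup>+x. v x - ennreal c \<partial>M)"
  proof (rule nn_integral_cong)
    fix x
    have "(\<integral>\<^sup>+s. indicator {c<..} s * indicator {s. ennreal s < v x} s \<partial>lborel)
        = (\<integral>\<^sup>+s. indicator ({c<..} \<inter> {s. ennreal s < v x}) s \<partial>lborel)"
      by (rule nn_integral_cong) (auto split: split_indicator)
    also have "\<dots> = emeasure lborel ({c<..} \<inter> {s. ennreal s < v x})"
      by (rule nn_integral_indicator) auto
    also have "\<dots> = v x - ennreal c"
    proof (cases "v x")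
      case (real r)
      then have "{c<..} \<inter> {s. ennreal s < v x} = {c<..<r}"
        using \<open>0 \<le> c\<close> by (auto simp: ennreal_less_iff)
      then show ?thesis
        using real \<open>0 \<le> c\<close> by (cases "c \<le> r") (simp_all add: ennreal_minus ennreal_neg)
    next
      case top
      have "emeasure lborel {c<..} = \<infinity>"
        by (rule emeasure_lborel_greaterThan)
      then show ?thesis using top by simp
    qed
    finally show "(\<integral>\<^sup>+s. indicator {c<..} s * indicator {s. ennreal s < v x} s \<partial>lborel) = v x - ennreal c" .
  qed
  finally show ?thesis .
qed

text \<open>\<open>trunc_integral M r v\<close> is the minimum over \<open>c\<close> of \<open>r c + \<integral> (v - c)\<^sub>+\<close>, which makes its
  subadditivity evident.\<close>

lemma trunc_integral_le:
  assumes [measurable]: "v \<in> borel_measurable M" and "0 \<le> c" "0 \<le> r"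
  shows "trunc_integral M r v \<le> ennreal r * ennreal c + (\<integral>\<^sup>+x. v x - ennreal c \<partial>M)"
proof -
  have "trunc_integral M r v \<le> (\<integral>\<^sup>+s. ennreal r * indicator {0..c} s
      + ennreal (dist_fun M v s) * indicator {c<..} s \<partial>lborel)"
    unfolding trunc_integral_def
    by (rule nn_integral_mono) (auto split: split_indicator intro: ennreal_leI)
  also have "\<dots> = ennreal r * ennreal c + (\<integral>\<^sup>+x. v x - ennreal c \<partial>M)"
    using assms(2) by (simp add: nn_integral_add nn_integral_cmult layer_cake_above)
  finally show ?thesis .
qed

text \<open>The optimal c is the decreasing rearrangement of \<open>v\<close> at r, the infimum of
  the levels where the distribution function is at most r. Below c the minimum in the integrand is
  r, above c it is the distribution function.\<close>

lemma trunc_integral_attained: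
  assumes [measurable]: "v \<in> borel_measurable M" and "0 < r" and "trunc_integral M r v < \<infinity>"
  obtains c where "0 \<le> c"
    "ennreal r * ennreal c + (\<integral>\<^sup>+x. v x - ennreal c \<partial>M) \<le> trunc_integral M r v"
proof -
  define T where "T = {s. 0 < s \<and> dist_fun M v s \<le> r}"
  \<comment> \<open>If every positive level had measure above r, the integrand would equal r on a
    half-line of infinite length.\<close>
  have "T \<noteq> {}"
  proof
    assume "T = {}"
    then have *: "dist_fun M v s > r" if "0 < s" for s
      using that by (force simp: T_def)
    have "(\<infinity>::ennreal) = (\<integral>\<^sup>+(s::real). ennreal r * indicator {0<..} s \<partial>lborel)"
      using \<open>0 < r\<close>
      by (subst nn_integral_cmult_indicator) (auto simp: emeasure_lborel_greaterThan ennreal_mult_top)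
    also have "\<dots> \<le> trunc_integral M r v"
      unfolding trunc_integral_def
      by (rule nn_integral_mono) (use * in \<open>force split: split_indicator\<close>)
    finally show False using assms(3) by simp
  qed
  define c where "c = Inf T"
  have bdd: "bdd_below T" by (rule bdd_belowI[of _ 0]) (simp add: T_def)
  have "0 \<le> c" unfolding c_def by (rule cInf_greatest) (use \<open>T \<noteq> {}\<close> in \<open>auto simp: T_def\<close>)
  have above: "dist_fun M v s \<le> r" if "c < s" for s
  proof -
    have "Inf T < s" using that by (simp add: c_def)
    then obtain t where "t \<in> T" "t < s"
      using cInf_lessD[OF \<open>T \<noteq> {}\<close>, of s] by auto
    then show ?thesis
      using dist_fun_antimono[of v t s] by (auto simp: T_def)
  qed
  have below: "r \<le> dist_fun M v s" if "0 < s" "s < c" for s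
  proof (rule ccontr)
    assume "\<not> r \<le> dist_fun M v s"
    then have "s \<in> T" using that by (simp add: T_def)
    then have "c \<le> s" unfolding c_def by (rule cInf_lower[OF _ bdd])
    then show False using that by simp
  qed
  have "ennreal r * ennreal c + (\<integral>\<^sup>+x. v x - ennreal c \<partial>M)
      = (\<integral>\<^sup>+s. ennreal r * indicator {0<..<c} s
      + ennreal (dist_fun M v s) * indicator {c<..} s \<partial>lborel)"
    using \<open>0 \<le> c\<close> by (simp add: nn_integral_add nn_integral_cmult layer_cake_above)
  also have "\<dots> \<le> trunc_integral M r v"
    unfolding trunc_integral_def
    by (rule nn_integral_mono)
      (use above below \<open>0 \<le> c\<close> \<open>0 < r\<close> in \<open>auto split: split_indicator simp: min_absorb1 min_absorb2\<close>)
  finally show ?thesis using that \<open>0 \<le> c\<close> by blast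
qed

text \<open>Choose an optimal c_i for each summand and use their sum as the competitor for
  \<open>v\<close>: the positive part of the sum of w_i - c_i is at most the sum of the positive
  parts. An infinite right-hand side is trivial.\<close>

lemma trunc_integral_suminf:
  fixes w :: "nat \<Rightarrow> 'a \<Rightarrow> ennreal"
  assumes [measurable]: "v \<in> borel_measurable M" "\<And>i. w i \<in> borel_measurable M"
    and le: "\<And>x. x \<in> space M \<Longrightarrow> v x \<le> (\<Sum>i. w i x)" and "0 < r"
  shows "trunc_integral M r v \<le> (\<Sum>i. trunc_integral M r (w i))"
proof (cases "(\<Sum>i. trunc_integral M r (w i)) < \<infinity>")
  case True
  have "trunc_integral M r (w i) < \<infinity>" for i
  proof -
    have "trunc_integral M r (w i) \<le> (\<Sum>i. trunc_integral M r (w i))"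
      using sum_le_suminf[of "\<lambda>i. trunc_integral M r (w i)" "{i}"] by simp
    then show ?thesis using True by (rule le_less_trans)
  qed
  then have "\<forall>i. \<exists>c\<ge>0. ennreal r * ennreal c + (\<integral>\<^sup>+x. w i x - ennreal c \<partial>M)
      \<le> trunc_integral M r (w i)"
    using trunc_integral_attained[of "w _" r] \<open>0 < r\<close> assms(2) by metis
  then obtain c where c: "\<And>i. 0 \<le> c i"
      "\<And>i. ennreal r * ennreal (c i) + (\<integral>\<^sup>+x. w i x - ennreal (c i) \<partial>M)
        \<le> trunc_integral M r (w i)"
    by metis
  have "(\<Sum>i. ennreal r * ennreal (c i) + (\<integral>\<^sup>+x. w i x - ennreal (c i) \<partial>M))
      \<le> (\<Sum>i. trunc_integral M r (w i))"
    by (intro suminf_le c) auto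
  also have "(\<Sum>i. ennreal r * ennreal (c i) + (\<integral>\<^sup>+x. w i x - ennreal (c i) \<partial>M))
      = ennreal r * (\<Sum>i. ennreal (c i)) + (\<integral>\<^sup>+x. (\<Sum>i. w i x - ennreal (c i)) \<partial>M)"
    by (simp add: suminf_add[symmetric] nn_integral_suminf)
  finally have *: "ennreal r * (\<Sum>i. ennreal (c i)) + (\<integral>\<^sup>+x. (\<Sum>i. w i x - ennreal (c i)) \<partial>M)
      \<le> (\<Sum>i. trunc_integral M r (w i))" .
  \<comment> \<open>The competitor has to be a finite level. Since r > 0, an infinite sum of the c_i
    would make the right-hand side infinite.\<close>
  have "(\<Sum>i. ennreal (c i)) \<noteq> \<infinity>"
    using * True \<open>0 < r\<close> by (auto simp: ennreal_mult_top)
  then obtain C where C: "0 \<le> C" "(\<Sum>i. ennreal (c i)) = ennreal C"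
    by (cases "(\<Sum>i. ennreal (c i))") auto
  have "trunc_integral M r v \<le> ennreal r * ennreal C + (\<integral>\<^sup>+x. v x - ennreal C \<partial>M)"
    using \<open>0 < r\<close> C by (intro trunc_integral_le) auto
  also have "(\<integral>\<^sup>+x. v x - ennreal C \<partial>M) \<le> (\<integral>\<^sup>+x. (\<Sum>i. w i x - ennreal (c i)) \<partial>M)"
  proof (rule nn_integral_mono)
    fix x assume "x \<in> space M"
    then have "v x \<le> (\<Sum>i. w i x)" by (rule le)
    also have "\<dots> \<le> (\<Sum>i. ennreal (c i) + (w i x - ennreal (c i)))"
      by (intro suminf_le) (metis ennreal_minus_le_iff ennreal_neq_top order_refl, auto)
    also have "\<dots> = ennreal C + (\<Sum>i. w i x - ennreal (c i))"
      by (simp add: suminf_add[symmetric] C)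
    finally show "v x - ennreal C \<le> (\<Sum>i. w i x - ennreal (c i))"
      by (simp add: ennreal_minus_le_iff)
  qed
  finally show ?thesis using * by (simp add: C)
next
  case False
  then show ?thesis by (simp add: not_less top_unique)
qed

text \<open>The concave function y^p is a mixture of the truncations min r y; the mixing density is
  minus its second derivative. This transfers subadditivity from \<open>trunc_integral\<close> to
  \<open>choquet\<close>.\<close>

lemma powr_eq_nn_integral_min:
  fixes p y :: real
  assumes "0 < p" "p < 1" "0 \<le> y"
  shows "ennreal (y powr p) = (\<integral>\<^sup>+r\<in>{0<..}. ennreal (p * (1 - p) * r powr (p - 2)) * ennreal (min r y) \<partial>lborel)"
proof (cases "y = 0")
  case True
  then show ?thesis using assms
    by (simp add: nn_integral_0_iff_AE) (auto simp: min_def ennreal_neg split: split_indicator)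
next
  case False
  then have y: "0 < y" using assms by simp
  have "(\<integral>\<^sup>+r\<in>{0<..}. ennreal (p * (1 - p) * r powr (p - 2)) * ennreal (min r y) \<partial>lborel)
      = (\<integral>\<^sup>+r. ennreal (p * (1 - p)) * (ennreal (r powr (p - 1)) * indicator {0<..<y} r)
        + ennreal (p * (1 - p) * y) * (ennreal (r powr (- (1 - p) - 1)) * indicator {y<..} r) \<partial>lborel)"
  proof (rule nn_integral_cong_AE)
    show "AE r in lborel. ennreal (p * (1 - p) * r powr (p - 2)) * ennreal (min r y) * indicator {0<..} r
      = ennreal (p * (1 - p)) * (ennreal (r powr (p - 1)) * indicator {0<..<y} r)
        + ennreal (p * (1 - p) * y) * (ennreal (r powr (- (1 - p) - 1)) * indicator {y<..} r)"
      using AE_lborel_singleton[of y]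
    proof eventually_elim
      case (elim r)
      have "r powr (p - 2) * r = r powr (p - 1)" if "0 < r"
        using that powr_mult_base[of r "p - 2"] by (simp add: mult.commute)
      then show ?case using elim assms y
        by (auto split: split_indicator simp: min_def ennreal_mult[symmetric] mult_ac)
    qed
  qed
  also have "\<dots> = ennreal (p * (1 - p)) * ennreal (y powr p / p)
      + ennreal (p * (1 - p) * y) * ennreal (y powr (- (1 - p)) / (1 - p))"
    using assms y
    by (subst nn_integral_add)
      (auto simp: nn_integral_cmult nn_integral_powr_from_0 nn_integral_powr_to_inf[of "1 - p" y, simplified])
  also have "\<dots> = ennreal ((1 - p) * y powr p + p * (y * y powr (- (1 - p))))"
  proof -
    have "p * (1 - p) * (y powr p / p) = (1 - p) * y powr p"
      "p * (1 - p) * y * (y powr (- (1 - p)) / (1 - p)) = p * (y * y powr (- (1 - p)))"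
      using assms by auto
    then show ?thesis
      using assms y by (simp add: ennreal_mult[symmetric] ennreal_plus[symmetric] del: ennreal_plus)
  qed
  also have "y * y powr (- (1 - p)) = y powr p"
    using y powr_mult_base[of y "- (1 - p)"] by simp
  finally show ?thesis by (simp add: algebra_simps)
qed

lemma choquet_eq_trunc_integral:
  assumes [measurable]: "v \<in> borel_measurable M" and p: "0 < p" "p < 1"
  shows "choquet p M v
    = (\<integral>\<^sup>+r\<in>{0<..}. ennreal (p * (1 - p) * r powr (p - 2)) * trunc_integral M r v \<partial>lborel)"
proof -
  have "choquet p M v = (\<integral>\<^sup>+s. (\<integral>\<^sup>+r. ennreal (p * (1 - p) * r powr (p - 2))
      * ennreal (min r (dist_fun M v s)) * indicator {0<..} r * indicator {0<..} s \<partial>lborel) \<partial>lborel)"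
    unfolding choquet_def using p
    by (intro nn_integral_cong) (simp add: powr_eq_nn_integral_min nn_integral_multc)
  also have "\<dots> = (\<integral>\<^sup>+r. (\<integral>\<^sup>+s. ennreal (p * (1 - p) * r powr (p - 2))
      * ennreal (min r (dist_fun M v s)) * indicator {0<..} r * indicator {0<..} s \<partial>lborel) \<partial>lborel)"
    by (rule lborel_pair.Fubini') simp
  also have "\<dots> = (\<integral>\<^sup>+r. (\<integral>\<^sup>+s. (ennreal (p * (1 - p) * r powr (p - 2)) * indicator {0<..} r)
      * (ennreal (min r (dist_fun M v s)) * indicator {0<..} s) \<partial>lborel) \<partial>lborel)"
    by (simp add: mult_ac)
  also have "\<dots> = (\<integral>\<^sup>+r\<in>{0<..}. ennreal (p * (1 - p) * r powr (p - 2)) * trunc_integral M r v \<partial>lborel)"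
    unfolding trunc_integral_def
    by (subst nn_integral_cmult) (auto simp: mult_ac)
  finally show ?thesis .
qed

text \<open>A positive mixture of the subadditive functionals \<open>trunc_integral M r\<close> is
  subadditive, and the mixture integral commutes with the series.\<close>

lemma choquet_suminf:
  fixes w :: "nat \<Rightarrow> 'a \<Rightarrow> ennreal"
  assumes [measurable]: "v \<in> borel_measurable M" "\<And>i. w i \<in> borel_measurable M"
    and le: "\<And>x. x \<in> space M \<Longrightarrow> v x \<le> (\<Sum>i. w i x)" and p: "0 < p" "p < 1"
  shows "choquet p M v \<le> (\<Sum>i. choquet p M (w i))"
proof -
  have [measurable]: "(\<lambda>r. trunc_integral M r (w i)) \<in> borel_measurable borel" for i
    unfolding trunc_integral_def by simp
  have "choquet p M v \<le> (\<integral>\<^sup>+r. (\<Sum>i. ennreal (p * (1 - p) * r powr (p - 2))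
      * trunc_integral M r (w i) * indicator {0<..} r) \<partial>lborel)"
    unfolding choquet_eq_trunc_integral[OF assms(1) p]
    by (intro nn_integral_mono)
      (auto split: split_indicator intro!: mult_left_mono trunc_integral_suminf le)
  also have "\<dots> = (\<Sum>i. choquet p M (w i))"
    using p by (subst nn_integral_suminf) (auto simp: choquet_eq_trunc_integral)
  finally show ?thesis .
qed

lemma choquet_cmult:
  assumes [measurable]: "v \<in> borel_measurable M" and "0 < c"
  shows "choquet p M (\<lambda>x. ennreal c * v x) = ennreal c * choquet p M v"
proof -
  have *: "dist_fun M (\<lambda>x. ennreal c * v x) (c * s) = dist_fun M v s" if "0 < s" for s
  proof -
    have "ennreal (c * s) < ennreal c * v x \<longleftrightarrow> ennreal s < v x" for x
      using \<open>0 < c\<close> that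
      by (cases "v x") (auto simp: ennreal_mult[symmetric] ennreal_mult_top ennreal_less_iff)
    then show ?thesis by (simp add: dist_fun_def)
  qed
  have "choquet p M (\<lambda>x. ennreal c * v x)
      = ennreal \<bar>c\<bar> * (\<integral>\<^sup>+s. ennreal (dist_fun M (\<lambda>x. ennreal c * v x) (0 + c * s) powr p)
        * indicator {0<..} (0 + c * s) \<partial>lborel)"
    unfolding choquet_def using \<open>0 < c\<close> by (subst nn_integral_real_affine[where c=c and t=0]) auto
  also have "\<dots> = ennreal c * choquet p M v"
  proof -
    have "ennreal (dist_fun M (\<lambda>x. ennreal c * v x) (0 + c * s) powr p) * indicator {0<..} (0 + c * s)
        = ennreal (dist_fun M v s powr p) * indicator {0<..} s" for s
      using \<open>0 < c\<close> * by (auto simp: zero_less_mult_iff split: split_indicator)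
    then show ?thesis
      unfolding choquet_def using \<open>0 < c\<close> by simp
  qed
  finally show ?thesis .
qed

end

section \<open>Dyadic levels and harmonic sums of indicators\<close>

lemma powr_le_one_plus:
  fixes y p :: real
  assumes "0 \<le> y" "0 < p" "p \<le> 1"
  shows "y powr p \<le> 1 + y"
proof (cases "y \<le> 1")
  case True
  then have "y powr p \<le> 1 powr p" using assms by (intro powr_mono2) auto
  then show ?thesis using assms by simp
next
  case False
  then have "y powr p \<le> y powr 1" using assms by (intro powr_mono) auto
  then show ?thesis using False by simp
qed

context finite_measure
begin

text \<open>The intervals \<open>J i\<close> are disjoint, and on each of them the distribution
  function is at least its value at the right endpoint 2^i. The factor 2 compensates for their
  length 2^i / 2.\<close>

lemma suminf_levels_le_choquet:
  assumes [measurable]: "v \<in> borel_measurable M" and "0 < p"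
  shows "(\<Sum>i. ennreal (2 ^ i * dist_fun M v (2 ^ i) powr p)) \<le> 2 * choquet p M v"
proof -
  define J where "J i = {(2::real) ^ i / 2<..2 ^ i}" for i :: nat
  have disj: "disjoint_family J"
  proof -
    have "J i \<inter> J j = {}" if "i < j" for i j
    proof -
      have "(2::real) ^ Suc i \<le> 2 ^ j" using that by (intro power_increasing) auto
      then show ?thesis by (auto simp: J_def)
    qed
    then show ?thesis by (auto simp: disjoint_family_on_def neq_iff)
  qed
  have "(\<Sum>i. ennreal (2 ^ i * dist_fun M v (2 ^ i) powr p))
      = (\<Sum>i. 2 * (\<integral>\<^sup>+s. ennreal (dist_fun M v (2 ^ i) powr p) * indicator (J i) s \<partial>lborel))"
    unfolding J_def
    by (intro suminf_cong, subst nn_integral_cmult_indicator)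
      (auto simp: ennreal_mult[symmetric] simp flip: ennreal_numeral)
  also have "\<dots> = 2 * (\<integral>\<^sup>+s. (\<Sum>i. ennreal (dist_fun M v (2 ^ i) powr p) * indicator (J i) s) \<partial>lborel)"
    by (simp add: nn_integral_suminf J_def)
  also have "\<dots> \<le> 2 * choquet p M v"
    unfolding choquet_def
  proof (rule mult_left_mono[OF nn_integral_mono])
    fix s :: real
    show "(\<Sum>i. ennreal (dist_fun M v (2 ^ i) powr p) * indicator (J i) s)
        \<le> ennreal (dist_fun M v s powr p) * indicator {0<..} s"
    proof (cases "\<exists>i. s \<in> J i")
      case True
      then obtain i where i: "s \<in> J i" ..
      then have "0 < s" using zero_less_power[of "2::real" i] by (simp add: J_def)
      have "(\<Sum>i. ennreal (dist_fun M v (2 ^ i) powr p) * indicator (J i) s)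
          = ennreal (dist_fun M v (2 ^ i) powr p)"
        by (rule suminf_cmult_indicator[OF disj i])
      also have "\<dots> \<le> ennreal (dist_fun M v s powr p)"
        using i \<open>0 < p\<close> by (intro ennreal_leI powr_mono2 dist_fun_antimono) (auto simp: J_def)
      finally show ?thesis using \<open>0 < s\<close> by simp
    next
      case False
      then show ?thesis by simp
    qed
  qed simp
  finally show ?thesis .
qed

lemma choquet_const:
  assumes "0 \<le> c" "0 < p"
  shows "choquet p M (\<lambda>x. ennreal c) = ennreal (c * measure M (space M) powr p)"
proof -
  have "choquet p M (\<lambda>x. ennreal c)
      = (\<integral>\<^sup>+s. ennreal (measure M (space M) powr p) * indicator {0<..<c} s \<partial>lborel)"
    unfolding choquet_def
  proof (rule nn_integral_cong)
    fix s :: real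
    show "ennreal (dist_fun M (\<lambda>x. ennreal c) s powr p) * indicator {0<..} s
        = ennreal (measure M (space M) powr p) * indicator {0<..<c} s"
    proof (cases "0 < s")
      case True
      then have "ennreal s < ennreal c \<longleftrightarrow> s < c" by (simp add: ennreal_less_iff)
      then show ?thesis using True by (cases "s < c") (simp_all add: dist_fun_def)
    qed simp
  qed
  also have "\<dots> = ennreal (c * measure M (space M) powr p)"
    using assms by (subst nn_integral_cmult_indicator) (auto simp: ennreal_mult[symmetric] mult.commute)
  finally show ?thesis .
qed

text \<open>On the range \<open>n\<^sup>-\<^sup>p \<le> s \<le> H\<^sub>n\<^sup>p\<close> the inequality
  \<open>(s\<^bsup>1/p\<^esup> d / \<delta>)\<^sup>p \<le> 1 + s\<^bsup>1/p\<^esup> d / \<delta>\<close> leaves two integrals that are both linear in \<open>H\<^sub>n\<close>: that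
  of \<open>1/s\<close>, which is \<open>p ln (n H\<^sub>n)\<close>, and a multiple of the \<open>L\<^sub>1\<close> norm of the sum.\<close>

lemma choquet_harmonic_sum:
  fixes A :: "nat \<Rightarrow> 'a set"
  assumes A [measurable]: "\<And>k. A k \<in> sets M" and le: "\<And>k. k \<in> {1..n} \<Longrightarrow> measure M (A k) \<le> \<delta>"
    and n: "1 \<le> n" and p: "0 < p" "p \<le> 1/2"
  shows "choquet p M (\<lambda>x. ennreal ((\<Sum>k=1..n. indicator (A k) x / real k) powr p))
    \<le> ennreal (4 * \<delta> powr p * harm n)"
proof -
  define G where "G x = (\<Sum>k=1..n. indicator (A k) x / real k)" for x
  have [measurable]: "G \<in> borel_measurable M" unfolding G_def by measurable
  define v where "v x = ennreal (G x powr p)" for x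
  have [measurable]: "v \<in> borel_measurable M" unfolding v_def by measurable
  define d where "d = dist_fun M v"
  have [measurable]: "d \<in> borel_measurable borel" unfolding d_def by simp
  have d0: "0 \<le> d s" for s by (simp add: d_def)
  define H :: real where "H = harm n"
  have H1: "1 \<le> H"
    using harm_mono[of 1 n, where 'a=real] n by (simp add: H_def harm_def)
  have \<delta>: "0 \<le> \<delta>" using order_trans[OF measure_nonneg le[of 1]] n by simp
  have G0: "0 \<le> G x" for x unfolding G_def by (intro sum_nonneg) auto
  have GH: "G x \<le> H" for x
    unfolding G_def H_def harm_def by (intro sum_mono) (auto simp: divide_simps split: split_indicator)
  have intG: "(\<integral>\<^sup>+x. ennreal (G x) \<partial>M) \<le> ennreal (\<delta> * H)"
  proof -
    have "(\<integral>\<^sup>+x. ennreal (G x) \<partial>M) = (\<integral>\<^sup>+x. (\<Sum>k=1..n. ennreal (1 / real k) * indicator (A k) x) \<partial>M)"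
    proof (rule nn_integral_cong)
      fix x
      have "ennreal (G x) = (\<Sum>k=1..n. ennreal (indicator (A k) x / real k))"
        unfolding G_def by (rule sum_ennreal[symmetric]) auto
      also have "\<dots> = (\<Sum>k=1..n. ennreal (1 / real k) * indicator (A k) x)"
        by (intro sum.cong) (auto split: split_indicator)
      finally show "ennreal (G x) = (\<Sum>k=1..n. ennreal (1 / real k) * indicator (A k) x)" .
    qed
    also have "\<dots> = (\<Sum>k=1..n. ennreal (1 / real k) * emeasure M (A k))"
      by (subst nn_integral_sum) (auto simp: nn_integral_cmult_indicator)
    also have "\<dots> = ennreal (\<Sum>k=1..n. 1 / real k * measure M (A k))"
      by (subst sum_ennreal[symmetric]) (auto simp: emeasure_eq_measure ennreal_mult[symmetric])
    also have "\<dots> \<le> ennreal (\<delta> * H)"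
      unfolding H_def harm_def sum_distrib_left
      by (intro ennreal_leI sum_mono) (use le in \<open>auto simp: divide_simps\<close>)
    finally show ?thesis .
  qed
  \<comment> \<open>This bound serves small levels, where the term 1/s of \<open>d_mid\<close> is
    not integrable, and it also settles the case \<delta> = 0.\<close>
  have d_le: "d s \<le> real n * \<delta>" if "0 < s" for s
  proof -
    have "{x \<in> space M. ennreal s < v x} \<subseteq> (\<Union>k\<in>{1..n}. A k)"
    proof
      fix x assume x: "x \<in> {x \<in> space M. ennreal s < v x}"
      show "x \<in> (\<Union>k\<in>{1..n}. A k)"
      proof (rule ccontr)
        assume "x \<notin> (\<Union>k\<in>{1..n}. A k)"
        then have "G x = 0" unfolding G_def by (intro sum.neutral) auto
        then show False using x by (simp add: v_def)
      qed
    qed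
    then have "d s \<le> measure M (\<Union>k\<in>{1..n}. A k)"
      unfolding d_def dist_fun_def by (intro finite_measure_mono) auto
    also have "\<dots> \<le> (\<Sum>k\<in>{1..n}. measure M (A k))"
      by (intro finite_measure_subadditive_finite) auto
    also have "\<dots> \<le> (\<Sum>k\<in>{1..n}. \<delta>)" by (intro sum_mono le)
    finally show ?thesis by simp
  qed
  have d_top: "d s = 0" if "H powr p < s" for s
  proof -
    have "v x \<le> ennreal s" for x
    proof -
      have "G x powr p \<le> H powr p" using GH G0 p by (intro powr_mono2) auto
      then show ?thesis unfolding v_def using that by (intro ennreal_leI) simp
    qed
    then have "{x \<in> space M. ennreal s < v x} = {}" by (auto simp: not_less)
    then show ?thesis unfolding d_def dist_fun_def by (simp only: measure_empty)
  qed
  have d_mid: "d s powr p \<le> \<delta> powr p * (1 / s) + \<delta> powr (p - 1) * (s powr (1/p - 1) * d s)"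
    if "0 < s" for s
  proof (cases "\<delta> = 0")
    case True
    then have "d s = 0" using d_le[OF that] d0[of s] by simp
    then show ?thesis using True by simp
  next
    case False
    then have "0 < \<delta>" using \<delta> by simp
    \<comment> \<open>The factor \<open>s powr (1/p)\<close> makes \<open>y powr p\<close>
      proportional to s. Dividing 1 + y by s then leaves 1/s and the weight
      \<open>s powr (1/p - 1)\<close>, which the layer-cake formula can integrate.\<close>
    define y where "y = s powr (1/p) * d s / \<delta>"
    have y: "0 \<le> y" unfolding y_def using \<delta> d0 by simp
    have "y powr p \<le> 1 + y" using y p by (intro powr_le_one_plus) auto
    moreover have "y powr p = s * d s powr p / \<delta> powr p"
      unfolding y_def using that d0 \<delta> p by (simp add: powr_divide powr_mult powr_powr)
    ultimately have "s * d s powr p / \<delta> powr p \<le> 1 + y" by simp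
    then have "d s powr p \<le> \<delta> powr p * (1 + y) / s"
      using that \<open>0 < \<delta>\<close> by (simp add: field_simps)
    also have "\<dots> = \<delta> powr p * (1 / s) + (\<delta> powr p / \<delta>) * (s powr (1/p) / s * d s)"
      using that \<open>0 < \<delta>\<close> by (simp add: y_def field_simps)
    also have "\<delta> powr p / \<delta> = \<delta> powr (p - 1)" using \<open>0 < \<delta>\<close> by (simp add: powr_diff)
    also have "s powr (1/p) / s = s powr (1/p - 1)" using that by (simp add: powr_diff)
    finally show ?thesis .
  qed
  \<comment> \<open>The cut \<open>a\<close> is chosen so that levels below it contribute exactly
    \<open>\<delta> powr p\<close>; above \<open>b\<close> the distribution function
    vanishes.\<close>
  define a b where "a = real n powr (- p)" and "b = H powr p"
  have a: "0 < a" "a \<le> 1" unfolding a_def using n p by (auto simp: powr_minus divide_simps ge_one_powr_ge_zero)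
  have b: "1 \<le> b" unfolding b_def using H1 p by (intro ge_one_powr_ge_zero) auto
  have "choquet p M v \<le> (\<integral>\<^sup>+s. ennreal ((real n * \<delta>) powr p) * indicator {0<..<a} s
      + ennreal (\<delta> powr p) * (ennreal (1 / s) * indicator {a..b} s)
      + ennreal (\<delta> powr (p - 1)) * (ennreal (s powr (1/p - 1)) * indicator {0<..} s * ennreal (d s)) \<partial>lborel)"
    unfolding choquet_def d_def[symmetric]
  proof (rule nn_integral_mono)
    fix s :: real
    show "ennreal (d s powr p) * indicator {0<..} s \<le> ennreal ((real n * \<delta>) powr p) * indicator {0<..<a} s
      + ennreal (\<delta> powr p) * (ennreal (1 / s) * indicator {a..b} s)
      + ennreal (\<delta> powr (p - 1)) * (ennreal (s powr (1/p - 1)) * indicator {0<..} s * ennreal (d s))"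
    proof -
      consider "s \<le> 0" | "0 < s" "s < a" | "0 < s" "a \<le> s" "s \<le> b" | "b < s" by linarith
      then show ?thesis
      proof cases
        case 1
        then show ?thesis by simp
      next
        case 2
        have "d s powr p \<le> (real n * \<delta>) powr p" using d_le 2 d0 p by (intro powr_mono2) auto
        then show ?thesis using 2 by (auto intro!: ennreal_leI add_increasing2)
      next
        case 3
        have "ennreal (d s powr p)
            \<le> ennreal (\<delta> powr p * (1 / s) + \<delta> powr (p - 1) * (s powr (1/p - 1) * d s))"
          using 3 by (intro ennreal_leI d_mid)
        moreover have "ennreal (\<delta> powr p / s) = ennreal (\<delta> powr p) * ennreal (1 / s)"
          using 3 by (simp add: ennreal_mult[symmetric])
        ultimately show ?thesis using 3 d0[of s] by (simp add: ennreal_mult)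
      next
        case 4
        then have "d s = 0" unfolding b_def by (intro d_top)
        then show ?thesis by simp
      qed
    qed
  qed
  also have "\<dots> = ennreal ((real n * \<delta>) powr p * a) + ennreal (\<delta> powr p) * ennreal (ln b - ln a)
      + ennreal (\<delta> powr (p - 1)) * (ennreal p * (\<integral>\<^sup>+x. ennreal (G x) \<partial>M))"
  proof -
    have "(\<integral>\<^sup>+s. ennreal (1 / s) * indicator {a..b} s \<partial>lborel) = ennreal (ln b - ln a)"
      using a b by (intro nn_integral_FTC_Icc) (auto intro!: derivative_eq_intros)
    \<comment> \<open>Since v = G^p, the inner integral of s^(1/p - 1) up to v is p G. The middle
      range is thus controlled by the L_1 norm of G.\<close>
    moreover have "(\<integral>\<^sup>+s. ennreal (s powr (1/p - 1)) * indicator {0<..} s * ennreal (d s) \<partial>lborel)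
        = ennreal p * (\<integral>\<^sup>+x. ennreal (G x) \<partial>M)"
    proof -
      have "(\<integral>\<^sup>+s. ennreal (s powr (1/p - 1)) * indicator {0<..} s * ennreal (d s) \<partial>lborel)
          = (\<integral>\<^sup>+x. (\<integral>\<^sup>+s. ennreal (s powr (1/p - 1)) * indicator {0<..} s
            * indicator {s. ennreal s < v x} s \<partial>lborel) \<partial>M)"
        unfolding d_def by (rule layer_cake) auto
      also have "\<dots> = (\<integral>\<^sup>+x. ennreal p * ennreal (G x) \<partial>M)"
      proof (rule nn_integral_cong)
        fix x
        have "(\<integral>\<^sup>+s. ennreal (s powr (1/p - 1)) * indicator {0<..} s
            * indicator {s. ennreal s < v x} s \<partial>lborel)
          = (\<integral>\<^sup>+s. ennreal (s powr (1/p - 1)) * indicator {0<..<G x powr p} s \<partial>lborel)"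
          by (intro nn_integral_cong) (auto simp: v_def ennreal_less_iff split: split_indicator)
        also have "\<dots> = ennreal ((G x powr p) powr (1/p) / (1/p))"
          using p by (intro nn_integral_powr_from_0) auto
        also have "\<dots> = ennreal p * ennreal (G x)"
          using p G0[of x] by (simp add: powr_powr ennreal_mult[symmetric] mult.commute)
        finally show "(\<integral>\<^sup>+s. ennreal (s powr (1/p - 1)) * indicator {0<..} s
            * indicator {s. ennreal s < v x} s \<partial>lborel) = ennreal p * ennreal (G x)" .
      qed
      finally show ?thesis by (simp add: nn_integral_cmult)
    qed
    ultimately show ?thesis
      using a by (simp add: nn_integral_add nn_integral_cmult ennreal_mult)
  qed
  also have "\<dots> \<le> ennreal ((real n * \<delta>) powr p * a) + ennreal (\<delta> powr p) * ennreal (ln b - ln a)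
      + ennreal (\<delta> powr (p - 1)) * (ennreal p * ennreal (\<delta> * H))"
    by (intro add_left_mono mult_left_mono intG) auto
  also have "\<dots> = ennreal (\<delta> powr p + \<delta> powr p * (ln b - ln a) + \<delta> powr p * (p * H))"
  proof -
    have "(real n * \<delta>) powr p * a = \<delta> powr p"
      using n \<delta> by (simp add: a_def powr_mult powr_minus field_simps)
    moreover have "\<delta> powr (p - 1) * (p * (\<delta> * H)) = \<delta> powr p * (p * H)"
      using \<delta> powr_mult_base[of \<delta> "p - 1"] by (cases "\<delta> = 0") (auto simp: mult_ac)
    moreover have "0 \<le> ln b - ln a" using a b by simp
    ultimately show ?thesis
      using p \<delta> H1 by (simp add: ennreal_mult[symmetric] ennreal_plus[symmetric] del: ennreal_plus)
  qed
  also have "\<dots> \<le> ennreal (4 * \<delta> powr p * H)"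
  proof (rule ennreal_leI)
    have "ln b - ln a = p * (ln H + ln n)"
      using n H1 by (simp add: a_def b_def ln_powr algebra_simps)
    also have "\<dots> \<le> p * (H + H)"
    proof -
      have "ln H \<le> H" using H1 ln_le_minus_one[of H] by simp
      moreover have "ln (real n) \<le> H"
      proof -
        have "ln (real n) \<le> ln (real n + 1)" using n by simp
        then show ?thesis using ln_le_harm[of n] by (simp add: H_def)
      qed
      ultimately show ?thesis using p by (intro mult_left_mono) auto
    qed
    finally have "1 + (ln b - ln a) + p * H \<le> 1 + p * (3 * H)" by (simp add: algebra_simps)
    \<comment> \<open>Here 1 <= H absorbs the constant term and p <= 1/2 the factor p; the resulting
      5/2 is rounded up to 4.\<close>
    also have "\<dots> \<le> H + 1/2 * (3 * H)" using p H1 by (intro add_mono mult_right_mono) auto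
    also have "\<dots> \<le> 4 * H" using H1 by simp
    finally have "\<delta> powr p * (1 + (ln b - ln a) + p * H) \<le> \<delta> powr p * (4 * H)"
      by (intro mult_left_mono) auto
    then show "\<delta> powr p + \<delta> powr p * (ln b - ln a) + \<delta> powr p * (p * H) \<le> 4 * \<delta> powr p * H"
      by (simp add: algebra_simps)
  qed
  finally show ?thesis unfolding v_def[abs_def] G_def H_def .
qed

end

section \<open>Decreasing rearrangements and the Lorentz functional as a Choquet integral\<close>

lemma finite_measure_unit_leb: "finite_measure unit_leb"
  by (rule finite_measure_lebesgue_on) auto

interpretation unit_leb: finite_measure unit_leb
  by (rule finite_measure_unit_leb)

lemma measure_unit_leb_space: "measure unit_leb {0<..<1} = 1"
  by (simp add: measure_restrict_space)

lemma sets_norm_greater: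
  fixes f :: "real \<Rightarrow> 'a::real_normed_vector"
  assumes [measurable]: "f \<in> borel_measurable unit_leb"
  shows "{x \<in> {0<..<1}. norm (f x) > s} \<in> sets unit_leb"
proof -
  have "{x \<in> space unit_leb. norm (f x) > s} \<in> sets unit_leb" by measurable
  then show ?thesis by simp
qed

text \<open>The level sets decrease to the empty set, so their measures tend to 0. Hence the infimum
  defining \<open>decr_rearr\<close> is never the arbitrary value of \<open>Inf\<close> on the empty
  set.\<close>

lemma decr_rearr_set_nonempty:
  fixes f :: "real \<Rightarrow> 'a::real_normed_vector"
  assumes "f \<in> borel_measurable unit_leb" and "0 < t"
  shows "{s. s > 0 \<and> measure unit_leb {x \<in> {0<..<1}. norm (f x) > s} \<le> t} \<noteq> {}"
proof -
  note sets = sets_norm_greater[OF assms(1)]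
  define d where "d s = measure unit_leb {x \<in> {0<..<1}. norm (f x) > s}" for s
    have "(\<lambda>n. d (real n)) \<longlonglongrightarrow> measure unit_leb (\<Inter>n. {x \<in> {0<..<1}. norm (f x) > real n})"
      unfolding d_def
      by (rule unit_leb.finite_Lim_measure_decseq) (use sets in \<open>auto simp: decseq_def\<close>)
    also have "(\<Inter>n. {x \<in> {0<..<1}. norm (f x) > real n}) = {}"
    proof -
      have "\<exists>n. \<not> real n < norm (f x)" for x
        using reals_Archimedean2[of "norm (f x)"] by (auto intro: less_imp_le simp: not_less)
      then show ?thesis by blast
    qed
    finally have "\<forall>\<^sub>F n in sequentially. d (real n) < t"
      using \<open>0 < t\<close> by (intro order_tendstoD) auto
    then obtain n where n: "\<And>m. n \<le> m \<Longrightarrow> d (real m) < t"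
      unfolding eventually_sequentially by blast
    \<comment> \<open>Passing to the successor keeps the level strictly positive, as membership in
      the set requires.\<close>
    have "0 < real (Suc n) \<and> d (real (Suc n)) \<le> t" using n[of "Suc n"] by simp
    then show ?thesis unfolding d_def by blast
qed

lemma decr_rearr_nonneg:
  fixes f :: "real \<Rightarrow> 'a::real_normed_vector"
  assumes "f \<in> borel_measurable unit_leb" and "0 < t"
  shows "0 \<le> decr_rearr f t"
  unfolding decr_rearr_def by (rule cInf_greatest[OF decr_rearr_set_nonempty[OF assms]]) auto

text \<open>The rearrangement and the distribution function are generalized inverses of each other.
  The implication from right to left rests on right continuity of the distribution function.\<close>

lemma less_decr_rearr_iff:
  fixes f :: "real \<Rightarrow> 'a::real_normed_vector"
  assumes [measurable]: "f \<in> borel_measurable unit_leb" and "0 < t" "0 < s"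
  shows "s < decr_rearr f t \<longleftrightarrow> t < measure unit_leb {x \<in> {0<..<1}. norm (f x) > s}"
proof -
  define d where "d s = measure unit_leb {x \<in> {0<..<1}. norm (f x) > s}" for s
  note sets [measurable] = sets_norm_greater[OF assms(1)]
  have d_mono: "d u \<le> d s" if "s \<le> u" for s u
    unfolding d_def by (rule unit_leb.finite_measure_mono[OF _ sets]) (use that in auto)
  define S where "S = {s. 0 < s \<and> d s \<le> t}"
  have decr: "decr_rearr f t = Inf S" by (simp add: S_def decr_rearr_def d_def)
  have bdd: "bdd_below S" by (rule bdd_belowI[of _ 0]) (auto simp: S_def)
  have "S \<noteq> {}"
    using decr_rearr_set_nonempty[OF assms(1,2)] by (simp add: S_def d_def)
  show ?thesis
    unfolding decr d_def[symmetric]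
  proof
    assume "s < Inf S"
    then show "t < d s" using cInf_lower[OF _ bdd, of s] \<open>0 < s\<close> by (force simp: S_def)
  next
    assume "t < d s"
    \<comment> \<open>Right continuity supplies a level strictly above s whose measure still exceeds
      t; this level is a lower bound of S, which gives the strict inequality.\<close>
    have "(\<lambda>n. d (s + 1 / Suc n)) \<longlonglongrightarrow> measure unit_leb (\<Union>n. {x \<in> {0<..<1}. norm (f x) > s + 1 / Suc n})"
      unfolding d_def
    proof (rule unit_leb.finite_Lim_measure_incseq)
      show "range (\<lambda>n. {x \<in> {0<..<1}. s + 1 / real (Suc n) < norm (f x)}) \<subseteq> sets unit_leb"
        using sets by blast
      show "incseq (\<lambda>n. {x \<in> {0<..<1}. s + 1 / real (Suc n) < norm (f x)})"
      proof (rule incseq_SucI)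
        fix n
        have "1 / real (Suc (Suc n)) \<le> 1 / real (Suc n)" by (simp add: divide_simps)
        then show "{x \<in> {0<..<1}. s + 1 / real (Suc n) < norm (f x)}
            \<subseteq> {x \<in> {0<..<1}. s + 1 / real (Suc (Suc n)) < norm (f x)}" by auto
      qed
    qed
    also have "(\<Union>n. {x \<in> {0<..<1}. norm (f x) > s + 1 / Suc n}) = {x \<in> {0<..<1}. norm (f x) > s}"
    proof -
      have "s < y \<longleftrightarrow> (\<exists>n. s + 1 / real (Suc n) < y)" for y
      proof
        assume "s < y"
        then obtain n where "inverse (real (Suc n)) < y - s"
          using reals_Archimedean[of "y - s"] by auto
        then show "\<exists>n. s + 1 / real (Suc n) < y" by (intro exI[of _ n]) (simp add: inverse_eq_divide)
      next
        assume "\<exists>n. s + 1 / real (Suc n) < y"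
        then obtain n where "s + 1 / real (Suc n) < y" ..
        moreover have "0 < 1 / real (Suc n)" by simp
        ultimately show "s < y" by linarith
      qed
      then show ?thesis by auto
    qed
    finally have "\<forall>\<^sub>F n in sequentially. t < d (s + 1 / Suc n)"
      using \<open>t < d s\<close> unfolding d_def[symmetric] by (intro order_tendstoD)
    then obtain n where n: "t < d (s + 1 / Suc n)"
      unfolding eventually_sequentially by blast
    have "s + 1 / Suc n \<le> Inf S"
    proof (rule cInf_greatest[OF \<open>S \<noteq> {}\<close>])
      fix u assume "u \<in> S"
      then show "s + 1 / Suc n \<le> u"
        using n d_mono[of u "s + 1 / Suc n"] by (force simp: S_def)
    qed
    moreover have "0 < 1 / real (Suc n)" by simp
    ultimately show "s < Inf S" by linarith
  qed
qed

text \<open>Both sides integrate t^(q/2 - 1) over one planar region, described either by s < f*(t)^q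
  or by t < D(s). Integrating first in s gives the Lorentz integral, first in t gives 2/q times the
  Choquet integral.\<close>

lemma lorentz2_integral_eq_choquet:
  fixes f :: "real \<Rightarrow> 'a::real_normed_vector"
  assumes [measurable]: "f \<in> borel_measurable unit_leb" and q: "0 < q"
  shows "lorentz2_integral q f
    = ennreal (2 / q) * choquet (q / 2) unit_leb (\<lambda>x. ennreal (norm (f x) powr q))"
proof -
  define v where "v x = ennreal (norm (f x) powr q)" for x
  have [measurable]: "v \<in> borel_measurable unit_leb" unfolding v_def by measurable
  define D where "D = dist_fun unit_leb v"
  have [measurable]: "D \<in> borel_measurable borel" unfolding D_def by simp
  have D0: "0 \<le> D s" for s by (simp add: D_def)
  have iff: "s < decr_rearr f t powr q \<longleftrightarrow> t < D s" if "0 < t" "0 < s" for s t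
  proof -
    let ?u = "s powr (1/q)"
    have less: "s < y powr q \<longleftrightarrow> ?u < y" if "0 \<le> y" for y
    proof -
      have "s = ?u powr q" using q \<open>0 < s\<close> by (simp add: powr_powr)
      then have "s < y powr q \<longleftrightarrow> ?u powr q < y powr q" by simp
      also have "\<dots> \<longleftrightarrow> ?u < y"
        using q that powr_less_mono2[of q ?u y] powr_mono2[of q y ?u] by (auto simp: not_less[symmetric])
      finally show ?thesis .
    qed
    have "s < decr_rearr f t powr q \<longleftrightarrow> ?u < decr_rearr f t"
      using decr_rearr_nonneg[OF assms(1) \<open>0 < t\<close>] by (rule less)
    also have "\<dots> \<longleftrightarrow> t < measure unit_leb {x \<in> {0<..<1}. norm (f x) > ?u}"
      using that by (intro less_decr_rearr_iff) auto
    also have "{x \<in> {0<..<1}. norm (f x) > ?u} = {x \<in> space unit_leb. ennreal s < v x}"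
      using \<open>0 < s\<close> by (auto simp: v_def ennreal_less_iff less)
    finally show ?thesis by (simp add: D_def dist_fun_def)
  qed
  have "lorentz2_integral q f = (\<integral>\<^sup>+t. (\<integral>\<^sup>+s. ennreal (t powr (q/2 - 1)) * indicator {0<..} t
      * indicator {0<..} s * indicator {t. t < D s} t \<partial>lborel) \<partial>lborel)"
    unfolding lorentz2_integral_def
  proof (rule nn_integral_cong)
    fix t :: real
    show "ennreal ((t powr (1/2) * decr_rearr f t) powr q / t) * indicator {0<..} t
      = (\<integral>\<^sup>+s. ennreal (t powr (q/2 - 1)) * indicator {0<..} t
      * indicator {0<..} s * indicator {t. t < D s} t \<partial>lborel)"
    proof (cases "0 < t")
      case True
      let ?y = "decr_rearr f t powr q"
      have "(t powr (1/2) * decr_rearr f t) powr q / t = t powr (q/2 - 1) * ?y"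
        using True decr_rearr_nonneg[OF assms(1) True] by (simp add: powr_mult powr_powr powr_diff)
      then have "ennreal ((t powr (1/2) * decr_rearr f t) powr q / t) * indicator {0<..} t
          = ennreal (t powr (q/2 - 1)) * (\<integral>\<^sup>+s. indicator {0<..<?y} s \<partial>lborel)"
        using True by (simp add: ennreal_mult)
      also have "\<dots> = (\<integral>\<^sup>+s. ennreal (t powr (q/2 - 1)) * indicator {0<..<?y} s \<partial>lborel)"
        by (simp add: nn_integral_cmult)
      also have "\<dots> = (\<integral>\<^sup>+s. ennreal (t powr (q/2 - 1)) * indicator {0<..} t
          * indicator {0<..} s * indicator {t. t < D s} t \<partial>lborel)"
        using True iff by (intro nn_integral_cong) (auto split: split_indicator)
      finally show ?thesis .
    qed simp
  qed
  also have "\<dots> = (\<integral>\<^sup>+s. (\<integral>\<^sup>+t. ennreal (t powr (q/2 - 1)) * indicator {0<..} t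
      * indicator {0<..} s * indicator {t. t < D s} t \<partial>lborel) \<partial>lborel)"
    unfolding indicator_def by (rule lborel_pair.Fubini') measurable
  also have "\<dots> = (\<integral>\<^sup>+s. ennreal (2 / q) * (ennreal (D s powr (q / 2)) * indicator {0<..} s) \<partial>lborel)"
  proof (rule nn_integral_cong)
    fix s :: real
    have "(\<integral>\<^sup>+t. ennreal (t powr (q/2 - 1)) * indicator {0<..} t
        * indicator {0<..} s * indicator {t. t < D s} t \<partial>lborel)
      = (\<integral>\<^sup>+t. ennreal (t powr (q/2 - 1)) * indicator {0<..<D s} t * indicator {0<..} s \<partial>lborel)"
      by (intro nn_integral_cong) (auto split: split_indicator)
    also have "\<dots> = ennreal (D s powr (q/2) / (q/2)) * indicator {0<..} s"
      using q by (simp add: nn_integral_multc nn_integral_powr_from_0 D0)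
    also have "ennreal (D s powr (q/2) / (q/2)) = ennreal (2 / q) * ennreal (D s powr (q / 2))"
      using q by (simp add: ennreal_mult[symmetric] mult.commute)
    finally show "(\<integral>\<^sup>+t. ennreal (t powr (q/2 - 1)) * indicator {0<..} t
        * indicator {0<..} s * indicator {t. t < D s} t \<partial>lborel)
      = ennreal (2 / q) * (ennreal (D s powr (q / 2)) * indicator {0<..} s)"
      by (simp add: mult.assoc)
  qed
  also have "\<dots> = ennreal (2 / q) * choquet (q / 2) unit_leb v"
    unfolding choquet_def D_def[symmetric] by (simp add: nn_integral_cmult)
  finally show ?thesis unfolding v_def[abs_def] .
qed

lemma space_unit_leb: "space unit_leb = {0<..<1}"
  by simp

section \<open>Dyadic decomposition of the square function\<close>

lemma powr_add_le:
  fixes a b p :: real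
  assumes "0 \<le> a" "0 \<le> b" "0 < p" "p \<le> 1"
  shows "(a + b) powr p \<le> a powr p + b powr p"
proof (cases "a + b = 0")
  case False
  then have s: "0 < a + b" using assms by simp
  have *: "x * (a + b) powr p / (a + b) \<le> x powr p" if "0 \<le> x" "x \<le> a + b" for x
  proof -
    have "(x / (a + b)) powr 1 \<le> (x / (a + b)) powr p"
      using that s assms by (intro powr_mono') auto
    then have "x / (a + b) \<le> x powr p / (a + b) powr p"
      using that s by (simp add: powr_divide)
    then show ?thesis using s by (simp add: field_simps)
  qed
  have "(a + b) powr p = a * (a + b) powr p / (a + b) + b * (a + b) powr p / (a + b)"
    using s by (simp add: add_divide_distrib[symmetric] distrib_right[symmetric])
  also have "\<dots> \<le> a powr p + b powr p" using assms by (intro add_mono *) auto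
  finally show ?thesis .
qed (use assms in auto)

lemma powr_sum_le:
  fixes g :: "'b \<Rightarrow> real"
  assumes "\<And>i. i \<in> I \<Longrightarrow> 0 \<le> g i" "0 < p" "p \<le> 1"
  shows "(\<Sum>i\<in>I. g i) powr p \<le> (\<Sum>i\<in>I. g i powr p)"
  using assms(1)
proof (induction I rule: infinite_finite_induct)
  case (insert i I)
  have "(\<Sum>j\<in>insert i I. g j) powr p = (g i + (\<Sum>j\<in>I. g j)) powr p"
    using insert by simp
  also have "\<dots> \<le> g i powr p + (\<Sum>j\<in>I. g j) powr p"
    using insert assms by (intro powr_add_le sum_nonneg) auto
  also have "\<dots> \<le> g i powr p + (\<Sum>j\<in>I. g j powr p)"
    using insert by simp
  finally show ?case using insert by simp
qed auto

text \<open>In the inductive step a value y in the top dyadic block is already dominated by the last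
  summand alone; a smaller y falls under the induction hypothesis.\<close>

lemma powr_le_sum_levels:
  fixes y e :: real
  assumes "0 \<le> y" "0 \<le> e" "y \<le> 2 ^ (L + m)"
  shows "y powr e \<le> (2 ^ L) powr e
    + (\<Sum>i<m. (2 ^ (L + i + 1)) powr e * (if 2 ^ (L + i) < y then 1 else 0))"
  using assms(3)
proof (induction m)
  case 0
  then show ?case using assms by (simp add: powr_mono2)
next
  case (Suc m)
  show ?case
  proof (cases "y \<le> 2 ^ (L + m)")
    case True
    then show ?thesis using Suc.IH by simp
  next
    case False
    have "y powr e \<le> (2 ^ (L + m + 1)) powr e"
      using Suc.prems assms by (intro powr_mono2) auto
    also have "\<dots> \<le> (2 ^ L) powr e
        + (\<Sum>i<Suc m. (2 ^ (L + i + 1)) powr e * (if 2 ^ (L + i) < y then 1 else 0))"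
      using False by (auto intro!: add_nonneg_nonneg sum_nonneg)
    finally show ?thesis .
  qed
qed

context finite_measure
begin

text \<open>The cut-off \<open>L\<close> stays free so that the first summand, of lower order in
  \<open>harm n\<close>, can be traded against the tail of the series. The sequence \<delta> bounds
  the level sets uniformly in k, as a common majorant of the rearrangements provides.\<close>

lemma choquet_square_function_le:
  fixes u :: "nat \<Rightarrow> 'a \<Rightarrow> real" and \<delta> :: "nat \<Rightarrow> real"
  assumes u [measurable]: "\<And>k. k \<in> {1..n} \<Longrightarrow> u k \<in> borel_measurable M"
    and u0: "\<And>k x. 0 \<le> u k x"
    and le: "\<And>k i. k \<in> {1..n} \<Longrightarrow> measure M {x \<in> space M. 2 ^ i < u k x powr q} \<le> \<delta> i"
    and M: "measure M (space M) = 1" and n: "1 \<le> n" and q: "0 < q" "q \<le> 1"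
  shows "choquet (q / 2) M (\<lambda>x. ennreal (sqrt (\<Sum>k=1..n. (u k x)\<^sup>2 / real k) powr q))
    \<le> ennreal (2 ^ L * harm n powr (q / 2))
      + ennreal (8 * harm n) * (\<Sum>i. ennreal (2 ^ (i + L) * \<delta> (i + L) powr (q / 2)))"
proof -
  define p where "p = q / 2"
  have p: "0 < p" "p \<le> 1/2" "p < 1" using q by (auto simp: p_def)
  define H :: real where "H = harm n"
  have H: "0 < H" using n by (simp add: H_def)
  \<comment> \<open>Outside the summation range the set is taken empty, so that \<open>A i k\<close>
    is measurable for every k although \<open>u k\<close> is only known to be measurable inside the
    range.\<close>
  define A where "A i k = (if k \<in> {1..n} then {x \<in> space M. 2 ^ i < u k x powr q} else {})"
    for i k :: nat
  have [measurable]: "A i k \<in> sets M" for i k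
  proof (cases "k \<in> {1..n}")
    case True
    note u[OF True, measurable]
    show ?thesis using True by (simp add: A_def)
  qed (auto simp: A_def)
  define G where "G i x = (\<Sum>k=1..n. indicator (A i k) x / real k)" for i x
  have G0: "0 \<le> G i x" for i x unfolding G_def by (intro sum_nonneg) auto
  have [measurable]: "G i \<in> borel_measurable M" for i unfolding G_def by measurable
  \<comment> \<open>Index 0 carries the part below height 2^L; index \<open>Suc i\<close> carries
    level L + i, at the height 2^(L+i+1) of the upper end of its dyadic block.\<close>
  define w where "w j x = (case j of 0 \<Rightarrow> ennreal (2 ^ L * H powr p)
      | Suc i \<Rightarrow> ennreal (2 ^ (L + i + 1)) * ennreal (G (L + i) x powr p))" for j x
  have [measurable]: "w j \<in> borel_measurable M" for j
    unfolding w_def by (cases j) auto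
  define v where "v x = ennreal (sqrt (\<Sum>k=1..n. (u k x)\<^sup>2 / real k) powr q)" for x
  have [measurable]: "v \<in> borel_measurable M" unfolding v_def by measurable
  have "v x \<le> (\<Sum>j. w j x)" if x: "x \<in> space M" for x
  proof -
    \<comment> \<open>The number m of levels needed depends on x, so the pointwise bound is a finite
      sum that is afterwards enlarged to the whole series.\<close>
    obtain m where m: "\<And>k. k \<in> {1..n} \<Longrightarrow> u k x powr q \<le> 2 ^ (L + m)"
    proof -
      obtain m where m: "(\<Sum>k=1..n. u k x powr q) < 2 ^ m"
        using real_arch_pow[of 2 "\<Sum>k=1..n. u k x powr q"] by auto
      have "u k x powr q \<le> 2 ^ (L + m)" if "k \<in> {1..n}" for k
      proof -
        have "u k x powr q \<le> (\<Sum>k=1..n. u k x powr q)"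
          using that by (intro member_le_sum) auto
        also have "\<dots> \<le> 2 ^ m" using m by simp
        also have "\<dots> \<le> 2 ^ (L + m)" by (intro power_increasing) auto
        finally show ?thesis .
      qed
      then show ?thesis by (rule that)
    qed
    have sq: "(u k x)\<^sup>2 \<le> (2 ^ L) powr (1/p)
        + (\<Sum>i<m. (2 ^ (L + i + 1)) powr (1/p) * indicator (A (L + i) k) x)" if k: "k \<in> {1..n}" for k
    proof -
      have "(u k x)\<^sup>2 = (u k x powr q) powr (1/p)"
        using q u0[of k x] by (cases "u k x = 0") (simp_all add: p_def powr_powr)
      also have "\<dots> \<le> (2 ^ L) powr (1/p)
          + (\<Sum>i<m. (2 ^ (L + i + 1)) powr (1/p) * (if 2 ^ (L + i) < u k x powr q then 1 else 0))"
        using p m[OF k] by (intro powr_le_sum_levels) auto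
      also have "(\<lambda>i. (if 2 ^ (L + i) < u k x powr q then 1 else 0 :: real))
          = (\<lambda>i. indicator (A (L + i) k) x)"
        using k x by (auto simp: A_def)
      finally show ?thesis .
    qed
    have "(\<Sum>k=1..n. (u k x)\<^sup>2 / real k) \<le> (\<Sum>k=1..n. ((2 ^ L) powr (1/p)
        + (\<Sum>i<m. (2 ^ (L + i + 1)) powr (1/p) * indicator (A (L + i) k) x)) / real k)"
      by (intro sum_mono divide_right_mono sq) auto
    also have "\<dots> = (2 ^ L) powr (1/p) * H + (\<Sum>i<m. (2 ^ (L + i + 1)) powr (1/p) * G (L + i) x)"
    proof -
      have "(\<Sum>k=1..n. (2 ^ L) powr (1/p) / real k) = (2 ^ L) powr (1/p) * H"
        by (simp add: H_def harm_def sum_distrib_left divide_inverse)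
      moreover have "(\<Sum>k=1..n. (\<Sum>i<m. (2 ^ (L + i + 1)) powr (1/p) * indicator (A (L + i) k) x) / real k)
          = (\<Sum>i<m. (2 ^ (L + i + 1)) powr (1/p) * G (L + i) x)"
        unfolding sum_divide_distrib G_def sum_distrib_left
        by (subst sum.swap) simp
      ultimately show ?thesis by (simp add: add_divide_distrib sum.distrib)
    qed
    finally have "(\<Sum>k=1..n. (u k x)\<^sup>2 / real k) powr p \<le>
        ((2 ^ L) powr (1/p) * H + (\<Sum>i<m. (2 ^ (L + i + 1)) powr (1/p) * G (L + i) x)) powr p"
      using p by (intro powr_mono2) (auto intro!: sum_nonneg)
    \<comment> \<open>The p-th power is subadditive, and it cancels the exponent 1/p that turns
      levels of u^q into heights of u^2.\<close>
    also have "\<dots> \<le> ((2 ^ L) powr (1/p) * H) powr p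
        + (\<Sum>i<m. (2 ^ (L + i + 1)) powr (1/p) * G (L + i) x) powr p"
      using p H G0 by (intro powr_add_le sum_nonneg mult_nonneg_nonneg) auto
    also have "\<dots> \<le> ((2 ^ L) powr (1/p) * H) powr p
        + (\<Sum>i<m. ((2 ^ (L + i + 1)) powr (1/p) * G (L + i) x) powr p)"
      using p G0 by (intro add_left_mono powr_sum_le mult_nonneg_nonneg) auto
    also have "\<dots> = 2 ^ L * H powr p + (\<Sum>i<m. 2 ^ (L + i + 1) * G (L + i) x powr p)"
      using p by (simp add: powr_mult powr_powr)
    finally have "(\<Sum>k=1..n. (u k x)\<^sup>2 / real k) powr p
        \<le> 2 ^ L * H powr p + (\<Sum>i<m. 2 ^ (L + i + 1) * G (L + i) x powr p)" .
    moreover have "sqrt (\<Sum>k=1..n. (u k x)\<^sup>2 / real k) powr q = (\<Sum>k=1..n. (u k x)\<^sup>2 / real k) powr p"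
      by (simp add: powr_half_sqrt[symmetric] sum_nonneg powr_powr p_def)
    ultimately have "v x \<le> ennreal (2 ^ L * H powr p + (\<Sum>i<m. 2 ^ (L + i + 1) * G (L + i) x powr p))"
      unfolding v_def by (intro ennreal_leI) simp
    also have "\<dots> = w 0 x + (\<Sum>i<m. w (Suc i) x)"
    proof -
      have "(\<Sum>i<m. w (Suc i) x) = (\<Sum>i<m. ennreal (2 ^ (L + i + 1) * G (L + i) x powr p))"
        by (intro sum.cong) (auto simp: w_def ennreal_mult)
      also have "\<dots> = ennreal (\<Sum>i<m. 2 ^ (L + i + 1) * G (L + i) x powr p)"
        by (rule sum_ennreal) auto
      finally show ?thesis by (simp add: w_def sum_nonneg)
    qed
    also have "\<dots> = (\<Sum>j<Suc m. w j x)" by (rule sum.lessThan_Suc_shift[symmetric])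
    also have "\<dots> \<le> (\<Sum>j. w j x)" by (rule sum_le_suminf) auto
    finally show ?thesis .
  qed
  then have "choquet p M v \<le> (\<Sum>j. choquet p M (w j))"
    using p by (intro choquet_suminf) auto
  also have "\<dots> = choquet p M (w 0) + (\<Sum>i. choquet p M (w (Suc i)))"
    using suminf_offset[of "\<lambda>j. choquet p M (w j)" 1] by (simp add: add.commute)
  also have "choquet p M (w 0) = ennreal (2 ^ L * H powr p)"
    unfolding w_def using p by (simp add: choquet_const M)
  also have "ennreal (2 ^ L * H powr p) + (\<Sum>i. choquet p M (w (Suc i)))
      \<le> ennreal (2 ^ L * H powr p) + (\<Sum>i. ennreal (8 * H) * ennreal (2 ^ (i + L) * \<delta> (i + L) powr p))"
  proof (rule add_left_mono, rule suminf_le)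
    fix i
    have \<delta>: "measure M (A (L + i) k) \<le> \<delta> (L + i)" if "k \<in> {1..n}" for k
      using le[OF that] that by (simp add: A_def)
    have "choquet p M (w (Suc i)) = ennreal (2 ^ (L + i + 1)) * choquet p M (\<lambda>x. ennreal (G (L + i) x powr p))"
      unfolding w_def by (simp add: choquet_cmult)
    also have "\<dots> \<le> ennreal (2 ^ (L + i + 1)) * ennreal (4 * \<delta> (L + i) powr p * H)"
      unfolding G_def H_def using p n \<delta> by (intro mult_left_mono choquet_harmonic_sum) auto
    \<comment> \<open>The 8 is 4 from \<open>choquet_harmonic_sum\<close> times 2 from using the
      upper end of the dyadic block.\<close>
    also have "\<dots> = ennreal (8 * H) * ennreal (2 ^ (i + L) * \<delta> (i + L) powr p)"
      using H by (simp add: ennreal_mult[symmetric] mult_ac add.commute)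
    finally show "choquet p M (w (Suc i)) \<le> \<dots>" .
  qed auto
  also have "(\<Sum>i. ennreal (8 * H) * ennreal (2 ^ (i + L) * \<delta> (i + L) powr p))
      = ennreal (8 * H) * (\<Sum>i. ennreal (2 ^ (i + L) * \<delta> (i + L) powr p))"
    by simp
  finally show ?thesis unfolding v_def[abs_def] p_def H_def .
qed

end

section \<open>Little-o estimate for the square function\<close>

text \<open>First fix L with \<tau> L below \<epsilon>/2; the factor 2^L is then a constant, and h^p
  is negligible against h because p < 1.\<close>

lemma smallo_if_le_powr_plus_tail:
  fixes c h :: "nat \<Rightarrow> real"
  assumes h: "filterlim h at_top sequentially" and p: "p < 1"
    and c0: "\<And>n. 0 \<le> c n"
    and le: "\<And>L n. 1 \<le> n \<Longrightarrow> c n \<le> 2 ^ L * h n powr p + h n * \<tau> L" and \<tau>: "\<tau> \<longlonglongrightarrow> 0"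
  shows "c \<in> o(h)"
proof (rule landau_o.smallI)
  fix \<epsilon> :: real assume "0 < \<epsilon>"
  obtain L where L: "\<tau> L < \<epsilon> / 2"
    using order_tendstoD(2)[OF \<tau>, of "\<epsilon> / 2"] \<open>0 < \<epsilon>\<close> by (auto simp: eventually_sequentially)
  have "((\<lambda>n. h n powr (p - 1)) \<longlongrightarrow> 0) sequentially"
    using p h by (intro tendsto_neg_powr) auto
  then have "\<forall>\<^sub>F n in sequentially. h n powr (p - 1) < \<epsilon> / 2 / 2 ^ L"
    using \<open>0 < \<epsilon>\<close> by (intro order_tendstoD) auto
  moreover have "\<forall>\<^sub>F n in sequentially. 1 \<le> h n" using h by (simp add: filterlim_at_top)
  moreover have "\<forall>\<^sub>F n in sequentially. 1 \<le> n" by (rule eventually_ge_at_top)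
  ultimately show "\<forall>\<^sub>F n in sequentially. norm (c n) \<le> \<epsilon> * norm (h n)"
  proof eventually_elim
    case (elim n)
    have "h n powr p = h n powr (p - 1) * h n"
      using elim powr_mult_base[of "h n" "p - 1"] by (simp add: mult.commute)
    also have "2 ^ L * \<dots> \<le> 2 ^ L * (\<epsilon> / 2 / 2 ^ L * h n)"
      using elim by (intro mult_left_mono mult_right_mono) auto
    finally have "2 ^ L * h n powr p \<le> \<epsilon> / 2 * h n" by simp
    moreover have "h n * \<tau> L \<le> \<epsilon> / 2 * h n" using L elim by simp
    moreover have "c n \<le> 2 ^ L * h n powr p + h n * \<tau> L" using elim by (intro le)
    moreover have "\<epsilon> / 2 * h n + \<epsilon> / 2 * h n = \<epsilon> * h n" by simp
    ultimately have "c n \<le> \<epsilon> * h n" by linarith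
    then show ?case using c0[of n] elim by simp
  qed
qed

lemma summable_tail_tendsto_0:
  fixes g :: "nat \<Rightarrow> 'b::real_normed_vector"
  assumes "summable g"
  shows "(\<lambda>L. \<Sum>i. g (i + L)) \<longlonglongrightarrow> 0"
proof -
  have "(\<lambda>L. suminf g - (\<Sum>i<L. g i)) \<longlonglongrightarrow> suminf g - suminf g"
    by (intro tendsto_intros summable_LIMSEQ assms)
  then show ?thesis by (simp add: suminf_minus_initial_segment[OF assms])
qed

text \<open>The rearrangement hypothesis is converted into a bound on all level sets of
  \<open>fs k\<close> by those of f. Membership of f in the Lorentz space makes the dyadic series
  \<open>g\<close> summable, so its tails tend to 0.\<close>

lemma lorentz2_choquet_square_fun:
  fixes q :: real and f :: "real \<Rightarrow> 'a::real_normed_vector" and fs :: "nat \<Rightarrow> real \<Rightarrow> 'a"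
  assumes q: "0 < q" "q \<le> 1" and f: "f \<in> lorentz2 q"
    and fs: "\<And>k. k \<ge> 1 \<Longrightarrow> fs k \<in> lorentz2 q"
    and rearr: "\<And>k t. k \<ge> 1 \<Longrightarrow> t > 0 \<Longrightarrow> decr_rearr (fs k) t \<le> decr_rearr f t"
  shows "choquet (q / 2) unit_leb (\<lambda>x. ennreal (square_fun fs n x powr q)) < \<infinity>" (is ?fin)
    and "(\<lambda>n. enn2real (choquet (q / 2) unit_leb (\<lambda>x. ennreal (square_fun fs n x powr q)))) \<in> o(harm)"
      (is ?o)
proof -
  have f_meas [measurable]: "f \<in> borel_measurable unit_leb" using f by (simp add: lorentz2_def)
  have fs_meas: "fs k \<in> borel_measurable unit_leb" if "1 \<le> k" for k
    using fs[OF that] by (simp add: lorentz2_def)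
  define v where "v x = ennreal (norm (f x) powr q)" for x
  have [measurable]: "v \<in> borel_measurable unit_leb" unfolding v_def by measurable
  define C where "C n = choquet (q / 2) unit_leb (\<lambda>x. ennreal (square_fun fs n x powr q))" for n
  define \<delta> where "\<delta> i = dist_fun unit_leb v (2 ^ i)" for i :: nat
  define g where "g i = 2 ^ i * \<delta> i powr (q / 2)" for i
  have \<delta>0: "0 \<le> \<delta> i" for i by (simp add: \<delta>_def)
  have g0: "0 \<le> g i" for i by (simp add: g_def)
  have level: "{x \<in> {0<..<1}. norm (h x) > (2 ^ i) powr (1/q)} = {x \<in> {0<..<1}. 2 ^ i < norm (h x) powr q}"
    for h :: "real \<Rightarrow> 'a" and i :: nat
  proof -
    have "(2 ^ i) powr (1/q) < y \<longleftrightarrow> 2 ^ i < y powr q" if "0 \<le> y" for y :: real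
    proof -
      have eq: "((2 ^ i) powr (1/q)) powr q = (2 ^ i :: real)" using q by (simp add: powr_powr)
      show ?thesis
        using powr_less_mono2[of q "(2 ^ i) powr (1/q)" y] powr_mono2[of q y "(2 ^ i) powr (1/q)"] that q
        unfolding eq by (auto simp: not_less[symmetric])
    qed
    then show ?thesis by auto
  qed
  have \<delta>_eq: "\<delta> i = measure unit_leb {x \<in> {0<..<1}. 2 ^ i < norm (f x) powr q}" for i
  proof -
    have "ennreal (2 ^ i) < ennreal y \<longleftrightarrow> 2 ^ i < y" for y by (rule ennreal_less_iff) simp
    then show ?thesis by (simp only: \<delta>_def dist_fun_def v_def space_unit_leb)
  qed
  have \<delta>: "measure unit_leb {x \<in> {0<..<1}. 2 ^ i < norm (fs k x) powr q} \<le> \<delta> i" if k: "1 \<le> k" for i k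
  proof (rule ccontr)
    assume "\<not> ?thesis"
    then have less: "\<delta> i < measure unit_leb {x \<in> {0<..<1}. norm (fs k x) > (2 ^ i) powr (1/q)}"
      by (simp only: level not_le)
    \<comment> \<open>The midpoint lies strictly between the two measures and is positive, so the
      rearrangements may be compared there by \<open>less_decr_rearr_iff\<close>.\<close>
    define t where "t = (\<delta> i + measure unit_leb {x \<in> {0<..<1}. norm (fs k x) > (2 ^ i) powr (1/q)}) / 2"
    have t: "0 < t" "\<delta> i < t" "t < measure unit_leb {x \<in> {0<..<1}. norm (fs k x) > (2 ^ i) powr (1/q)}"
      using less \<delta>0[of i] by (simp_all add: t_def)
    then have "(2 ^ i) powr (1/q) < decr_rearr (fs k) t"
      by (subst less_decr_rearr_iff[OF fs_meas[OF k]]) auto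
    also have "\<dots> \<le> decr_rearr f t" using t k by (intro rearr) auto
    finally have "(2 ^ i) powr (1/q) < decr_rearr f t" .
    then have "t < measure unit_leb {x \<in> {0<..<1}. norm (f x) > (2 ^ i) powr (1/q)}"
      using t by (subst (asm) less_decr_rearr_iff[OF f_meas]) auto
    then have "t < \<delta> i" by (simp only: level \<delta>_eq)
    then show False using t by simp
  qed
  have "(\<Sum>i. ennreal (g i)) \<le> 2 * choquet (q / 2) unit_leb v"
    unfolding g_def \<delta>_def using q by (intro unit_leb.suminf_levels_le_choquet) auto
  also have "\<dots> < \<infinity>"
  proof -
    have "ennreal (2 / q) * choquet (q / 2) unit_leb v < \<infinity>"
      using f lorentz2_integral_eq_choquet[OF f_meas q(1)] by (simp add: lorentz2_def v_def[abs_def])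
    then show ?thesis using q by (auto simp: ennreal_mult_less_top)
  qed
  finally have sum_g: "summable g"
    using g0 by (intro summable_suminf_not_top) auto
  define \<tau> where "\<tau> L = 8 * (\<Sum>i. g (i + L))" for L
  have le: "C n \<le> ennreal (2 ^ L * harm n powr (q / 2) + harm n * \<tau> L)" if n: "1 \<le> n" for n L
  proof -
    have "C n \<le> ennreal (2 ^ L * harm n powr (q / 2)) + ennreal (8 * harm n) * (\<Sum>i. ennreal (g (i + L)))"
      unfolding C_def g_def square_fun_def
      using \<delta> fs_meas q n measure_unit_leb_space
      by (intro unit_leb.choquet_square_function_le) (auto simp: space_restrict_space)
    also have "(\<Sum>i. ennreal (g (i + L))) = ennreal (\<Sum>i. g (i + L))"
      using sum_g g0 by (intro suminf_ennreal2) (auto simp: summable_iff_shift)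
    finally show ?thesis
      using sum_g g0 by (simp add: \<tau>_def ennreal_mult[symmetric] ennreal_plus[symmetric] suminf_nonneg
          summable_iff_shift harm_nonneg mult_ac del: ennreal_plus)
  qed
  show ?fin
  \<comment> \<open>The estimate \<open>le\<close> starts at n = 1; for n = 0 the square function
    vanishes, and so does its q-th power.\<close>
  proof (cases "n = 0")
    case True
    then show ?thesis using unit_leb.choquet_const[of 0 "q / 2"] q by (simp add: square_fun_def)
  next
    case False
    then show ?thesis using le[of n 0] unfolding C_def by (simp add: le_less_trans)
  qed
  have \<tau>0: "0 \<le> \<tau> L" for L
    unfolding \<tau>_def using sum_g g0 by (auto intro!: suminf_nonneg simp: summable_iff_shift)
  have "(\<lambda>n. enn2real (C n)) \<in> o(harm)"
  proof (rule smallo_if_le_powr_plus_tail[OF harm_at_top])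
    show "q / 2 < 1" using q by simp
    show "\<tau> \<longlonglongrightarrow> 0"
      unfolding \<tau>_def[abs_def] using tendsto_mult[OF tendsto_const summable_tail_tendsto_0[OF sum_g], of 8] by simp
    show "enn2real (C n) \<le> 2 ^ L * harm n powr (q / 2) + harm n * \<tau> L" if "1 \<le> n" for L n
      using le[OF that] \<tau>0[of L] by (intro enn2real_leI) (auto intro!: add_nonneg_nonneg mult_nonneg_nonneg harm_nonneg)
  qed auto
  then show ?o by (simp add: C_def)
qed

section \<open>Weighted integral bounds for products\<close>

context finite_measure
begin

text \<open>For s <= 1 the distribution function is at most m(F). For s > 1 Markov's inequality with
  exponent 2/p bounds its p-th power by a multiple of s^(-2), whose tail integral is 1. In the
  application w = W^q and p = q/2, so the exponent 2/p produces W^4.\<close>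

lemma choquet_indicator_mult_le:
  fixes w :: "'a \<Rightarrow> real"
  assumes F [measurable]: "F \<in> sets M" and w [measurable]: "w \<in> borel_measurable M"
    and w0: "\<And>x. 0 \<le> w x" and p: "0 < p" "p \<le> 1"
  shows "choquet p M (\<lambda>x. ennreal (indicator F x * w x))
    \<le> ennreal (measure M F powr (p - 1)) * (\<integral>\<^sup>+x\<in>F. ennreal (2 + w x powr (2 / p)) \<partial>M)"
proof -
  define v where "v x = ennreal (indicator F x * w x)" for x
  define e where "e = measure M F"
  have sub: "{x \<in> space M. ennreal s < v x} \<subseteq> {x \<in> F. s < w x}" if "0 < s" for s
    using that sets.sets_into_space[OF F]
    by (auto simp: v_def ennreal_less_iff split: split_indicator_asm)
  have d_le: "dist_fun M v s \<le> e" if "0 < s" for s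
    unfolding dist_fun_def e_def using sub[OF that] by (intro finite_measure_mono) auto
  have "choquet p M v \<le> ennreal (e powr (p - 1)) * (\<integral>\<^sup>+x\<in>F. ennreal (2 + w x powr (2 / p)) \<partial>M)"
  proof (cases "e = 0")
    \<comment> \<open>Here \<open>0 powr (p - 1)\<close> is 0 by convention, so the left-hand side
      must vanish as well; it does, because the distribution function is at most e.\<close>
    case True
    have "ennreal (dist_fun M v s powr p) * indicator {0<..} s = 0" for s
    proof (cases "0 < s")
      case pos: True
      then have "dist_fun M v s = 0" using d_le[of s] True dist_fun_nonneg[of v s] by linarith
      then show ?thesis by simp
    qed simp
    then show ?thesis unfolding choquet_def by (subst nn_integral_cong[where v="\<lambda>_. 0"]) simp_all
  next
    case False
    then have e: "0 < e" by (simp add: e_def zero_less_measure_iff)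
    define Y where "Y = (\<integral>\<^sup>+x\<in>F. ennreal (w x powr (2 / p)) \<partial>M)"
    have split: "(\<integral>\<^sup>+x\<in>F. ennreal (2 + w x powr (2 / p)) \<partial>M) = ennreal (2 * e) + Y"
    proof -
      have "(\<integral>\<^sup>+x\<in>F. ennreal (2 + w x powr (2 / p)) \<partial>M)
          = (\<integral>\<^sup>+x. ennreal 2 * indicator F x + ennreal (w x powr (2 / p)) * indicator F x \<partial>M)"
        by (intro nn_integral_cong) (simp only: ennreal_plus powr_ge_zero zero_le_numeral distrib_right)
      also have "\<dots> = (\<integral>\<^sup>+x. ennreal 2 * indicator F x \<partial>M) + Y"
        unfolding Y_def by (rule nn_integral_add) auto
      also have "(\<integral>\<^sup>+x. ennreal 2 * indicator F x \<partial>M) = ennreal (2 * e)"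
        by (subst nn_integral_cmult_indicator)
          (auto simp: e_def emeasure_eq_measure ennreal_mult)
      finally show ?thesis .
    qed
    show ?thesis
    proof (cases Y)
      case top
      then show ?thesis using e by (simp only: split) (simp add: ennreal_mult_top)
    next
      case (real y)
      have markov: "dist_fun M v s \<le> s powr (- (2 / p)) * y" if "0 < s" for s
      proof -
        have "emeasure M {x \<in> space M. ennreal s < v x}
            \<le> emeasure M {x \<in> F. 1 \<le> ennreal (s powr (- (2 / p))) * ennreal (w x powr (2 / p))}"
        proof (rule emeasure_mono)
          show "{x \<in> space M. ennreal s < v x}
              \<subseteq> {x \<in> F. 1 \<le> ennreal (s powr (- (2 / p))) * ennreal (w x powr (2 / p))}"
          proof
            fix x assume "x \<in> {x \<in> space M. ennreal s < v x}"
            then have x: "x \<in> F" "s < w x" using sub[OF that] by auto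
            have "s powr (2 / p) \<le> w x powr (2 / p)" using x that p by (intro powr_mono2) auto
            then have "1 \<le> s powr (- (2 / p)) * w x powr (2 / p)"
              using that by (simp add: powr_minus field_simps)
            then have "1 \<le> ennreal (s powr (- (2 / p)) * w x powr (2 / p))" by simp
            then show "x \<in> {x \<in> F. 1 \<le> ennreal (s powr (- (2 / p))) * ennreal (w x powr (2 / p))}"
              using x by (simp add: ennreal_mult)
          qed
        qed measurable
        also have "\<dots> \<le> ennreal (s powr (- (2 / p))) * Y"
          unfolding Y_def by (rule nn_integral_Markov_inequality) auto
        also have "\<dots> = ennreal (s powr (- (2 / p)) * y)" using real by (simp add: ennreal_mult)
        finally show ?thesis
          using real by (simp add: dist_fun_def emeasure_eq_measure)
      qed
      have "choquet p M v \<le> (\<integral>\<^sup>+s. ennreal (e powr p) * indicator {0..1} s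
          + ennreal (y powr p) * (ennreal (s powr (- 1 - 1)) * indicator {1<..} s) \<partial>lborel)"
        unfolding choquet_def
      proof (rule nn_integral_mono)
        fix s :: real
        show "ennreal (dist_fun M v s powr p) * indicator {0<..} s
            \<le> ennreal (e powr p) * indicator {0..1} s
          + ennreal (y powr p) * (ennreal (s powr (- 1 - 1)) * indicator {1<..} s)"
        proof -
          consider "s \<le> 0" | "0 < s" "s \<le> 1" | "1 < s" by linarith
          then show ?thesis
          proof cases
            case 2
            then have "dist_fun M v s powr p \<le> e powr p"
              using d_le p by (intro powr_mono2) auto
            then show ?thesis using 2 by (simp add: ennreal_leI)
          next
            case 3
            then have "dist_fun M v s powr p \<le> (s powr (- (2 / p)) * y) powr p"
              using markov p by (intro powr_mono2) auto
            also have "\<dots> = y powr p * s powr (- 1 - 1)"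
              using real p by (simp add: powr_mult powr_powr mult.commute)
            finally have "ennreal (dist_fun M v s powr p) \<le> ennreal (y powr p) * ennreal (s powr (- 1 - 1))"
              by (simp add: ennreal_mult[symmetric] ennreal_leI)
            then show ?thesis using 3 by simp
          qed simp
        qed
      qed
      also have "\<dots> = ennreal (e powr p + y powr p)"
        using nn_integral_powr_to_inf[of 1 1]
        by (simp add: nn_integral_add nn_integral_cmult)
      also have "\<dots> \<le> ennreal (e powr (p - 1) * (2 * e + y))"
      proof (rule ennreal_leI)
        have ep: "e powr p = e powr (p - 1) * e"
          using e powr_mult_base[of e "p - 1"] by (simp add: mult.commute)
        \<comment> \<open>Normalizing by e before linearizing produces the factor
          \<open>e powr (p - 1)\<close> and makes the bound linear in y.\<close>
        have "(y / e) powr p \<le> 1 + y / e"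
          using e real p by (intro powr_le_one_plus) auto
        then have "y powr p \<le> e powr p * (1 + y / e)"
          using e real by (simp add: powr_divide field_simps)
        also have "\<dots> = e powr (p - 1) * (e + y)"
          using e by (simp add: ep field_simps)
        finally show "e powr p + y powr p \<le> e powr (p - 1) * (2 * e + y)"
          by (simp add: ep algebra_simps)
      qed
      also have "\<dots> = ennreal (e powr (p - 1)) * (\<integral>\<^sup>+x\<in>F. ennreal (2 + w x powr (2 / p)) \<partial>M)"
        using real e by (simp only: split) (simp add: ennreal_mult[symmetric] ennreal_plus[symmetric] del: ennreal_plus)
      finally show ?thesis .
    qed
  qed
  then show ?thesis unfolding v_def[abs_def] e_def .
qed

text \<open>The weight turns the Choquet functional of a product into an integral that is linear in a
  power of the second factor, so that averaging over signs can be carried out pointwise.\<close>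

lemma choquet_mult_weight:
  fixes y :: "'a \<Rightarrow> real"
  assumes y [measurable]: "y \<in> borel_measurable M" and M: "measure M (space M) = 1"
    and p: "0 < p" "p < 1"
  obtains \<psi> where "\<psi> \<in> borel_measurable M"
    "(\<integral>\<^sup>+x. \<psi> x \<partial>M) \<le> 1 + 4 * choquet p M (\<lambda>x. ennreal (y x))"
    "\<And>w. w \<in> borel_measurable M \<Longrightarrow> (\<And>x. 0 \<le> w x) \<Longrightarrow>
      choquet p M (\<lambda>x. ennreal (y x * w x)) \<le> (\<integral>\<^sup>+x. ennreal (2 + w x powr (2 / p)) * \<psi> x \<partial>M)"
proof -
  \<comment> \<open>\<open>F 0\<close> is the whole space and takes care of the points with y <= 1;
    \<open>F (Suc i)\<close> is the level set at 2^i.\<close>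
  define F where "F l = (case l of 0 \<Rightarrow> space M | Suc i \<Rightarrow> {x \<in> space M. 2 ^ i < y x})" for l
  have F [measurable]: "F l \<in> sets M" for l unfolding F_def by (cases l) auto
  \<comment> \<open>The power p - 1 is what \<open>choquet_indicator_mult_le\<close> yields on
    \<open>F l\<close>. Integrated over \<open>F l\<close>, the l-th term has mass 2^l
    m(F_l)^p.\<close>
  define \<psi> where "\<psi> x = (\<Sum>l. ennreal (2 ^ l) * (ennreal (measure M (F l) powr (p - 1)) * indicator (F l) x))" for x
  have \<psi> [measurable]: "\<psi> \<in> borel_measurable M" unfolding \<psi>_def by measurable
  show thesis
  proof (rule that[OF \<psi>])
    have "(\<integral>\<^sup>+x. \<psi> x \<partial>M) = (\<Sum>l. ennreal (2 ^ l * measure M (F l) powr p))"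
    proof -
      have "(\<integral>\<^sup>+x. ennreal (2 ^ l) * (ennreal (measure M (F l) powr (p - 1)) * indicator (F l) x) \<partial>M)
          = ennreal (2 ^ l * measure M (F l) powr p)" for l
      proof -
        have "measure M (F l) powr (p - 1) * measure M (F l) = measure M (F l) powr p"
          using powr_mult_base[of "measure M (F l)" "p - 1"] by (simp add: mult.commute)
        then show ?thesis
          by (simp add: nn_integral_cmult nn_integral_cmult_indicator emeasure_eq_measure
              ennreal_mult[symmetric] del: ennreal_power)
      qed
      then show ?thesis unfolding \<psi>_def by (subst nn_integral_suminf) auto
    qed
    \<comment> \<open>The term for \<open>F 0\<close> is 1 since the space has measure 1. The index
      shift costs a factor 2 and \<open>suminf_levels_le_choquet\<close> another 2, whence the
      constant 4.\<close>
    also have "\<dots> = 1 + (\<Sum>i. ennreal (2 ^ Suc i * dist_fun M (\<lambda>x. ennreal (y x)) (2 ^ i) powr p))"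
    proof -
      have "ennreal (2 ^ i) < ennreal (y x) \<longleftrightarrow> 2 ^ i < y x" for i x by (rule ennreal_less_iff) simp
      then have Suc: "measure M (F (Suc i)) = dist_fun M (\<lambda>x. ennreal (y x)) (2 ^ i)" for i
        by (simp only: F_def dist_fun_def nat.case)
      have "(\<Sum>l. ennreal (2 ^ l * measure M (F l) powr p))
          = (\<Sum>l. ennreal (2 ^ Suc l * measure M (F (Suc l)) powr p)) + ennreal (2 ^ 0 * measure M (F 0) powr p)"
        using suminf_offset[of "\<lambda>l. ennreal (2 ^ l * measure M (F l) powr p)" 1]
        by (simp only: summableI simp_thms add_Suc_right add_0_right One_nat_def sum.lessThan_Suc lessThan_0 sum.empty add_0)
      also have "F 0 = space M" by (simp add: F_def)
      finally show ?thesis by (simp only: Suc M) (simp add: add.commute)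
    qed
    also have "(\<Sum>i. ennreal (2 ^ Suc i * dist_fun M (\<lambda>x. ennreal (y x)) (2 ^ i) powr p))
        = 2 * (\<Sum>i. ennreal (2 ^ i * dist_fun M (\<lambda>x. ennreal (y x)) (2 ^ i) powr p))"
      by (subst ennreal_suminf_cmult[symmetric], intro suminf_cong)
        (simp add: ennreal_mult mult.assoc)
    also have "1 + \<dots> \<le> 1 + 2 * (2 * choquet p M (\<lambda>x. ennreal (y x)))"
      using p by (intro add_left_mono mult_left_mono suminf_levels_le_choquet) auto
    finally show "(\<integral>\<^sup>+x. \<psi> x \<partial>M) \<le> 1 + 4 * choquet p M (\<lambda>x. ennreal (y x))"
      by (simp add: mult.assoc[symmetric])
  next
    fix w :: "'a \<Rightarrow> real"
    assume w [measurable]: "w \<in> borel_measurable M" and w0: "\<And>x. 0 \<le> w x"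
    define u where "u l x = ennreal (2 ^ l) * ennreal (indicator (F l) x * w x)" for l x
    have [measurable]: "u l \<in> borel_measurable M" for l unfolding u_def by measurable
    have le: "ennreal (y x * w x) \<le> (\<Sum>l. u l x)" if x: "x \<in> space M" for x
    proof -
      \<comment> \<open>The least such exponent k places x in \<open>F k\<close>: for k = Suc j
        minimality says y x > 2^j. A single term of the series then dominates y w at x.\<close>
      have "\<exists>l. x \<in> F l \<and> y x \<le> 2 ^ l"
      proof (cases "y x \<le> 1")
        case True
        then show ?thesis using x by (intro exI[of _ 0]) (simp add: F_def)
      next
        case False
        obtain m where "y x < 2 ^ m" using real_arch_pow[of 2 "y x"] by auto
        then have ex: "y x \<le> 2 ^ m" by simp
        define k where "k = (LEAST k. y x \<le> 2 ^ k)"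
        have k: "y x \<le> 2 ^ k" unfolding k_def using ex by (rule LeastI)
        then have "k \<noteq> 0" using False by (cases k) auto
        then obtain j where j: "k = Suc j" by (cases k) auto
        have "\<not> y x \<le> 2 ^ j" using not_less_Least[of j "\<lambda>k. y x \<le> 2 ^ k"] j by (simp add: k_def)
        then show ?thesis using x k j by (intro exI[of _ "Suc j"]) (simp add: F_def)
      qed
      then obtain l where l: "x \<in> F l" "y x \<le> 2 ^ l" by blast
      have "ennreal (y x * w x) \<le> ennreal (2 ^ l * w x)"
        using l w0[of x] by (intro ennreal_leI mult_right_mono) auto
      also have "\<dots> = u l x" unfolding u_def using l w0[of x] by (simp add: ennreal_mult)
      also have "\<dots> \<le> (\<Sum>l. u l x)" using sum_le_suminf[of "\<lambda>l. u l x" "{l}"] by simp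
      finally show ?thesis .
    qed
    have "choquet p M (\<lambda>x. ennreal (y x * w x)) \<le> (\<Sum>l. choquet p M (u l))"
      using p le by (intro choquet_suminf) auto
    also have "\<dots> \<le> (\<Sum>l. \<integral>\<^sup>+x. ennreal (2 + w x powr (2 / p))
        * (ennreal (2 ^ l) * (ennreal (measure M (F l) powr (p - 1)) * indicator (F l) x)) \<partial>M)"
    proof (rule suminf_le)
      fix l
      have "choquet p M (u l) = ennreal (2 ^ l) * choquet p M (\<lambda>x. ennreal (indicator (F l) x * w x))"
        unfolding u_def by (rule choquet_cmult) auto
      also have "\<dots> \<le> ennreal (2 ^ l) * (ennreal (measure M (F l) powr (p - 1))
          * (\<integral>\<^sup>+x\<in>F l. ennreal (2 + w x powr (2 / p)) \<partial>M))"
        using p w0 by (intro mult_left_mono choquet_indicator_mult_le) auto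
      also have "\<dots> = (\<integral>\<^sup>+x. ennreal (2 ^ l) * (ennreal (measure M (F l) powr (p - 1))
          * (ennreal (2 + w x powr (2 / p)) * indicator (F l) x)) \<partial>M)"
        by (subst nn_integral_cmult, measurable, subst nn_integral_cmult) auto
      also have "\<dots> = (\<integral>\<^sup>+x. ennreal (2 + w x powr (2 / p))
        * (ennreal (2 ^ l) * (ennreal (measure M (F l) powr (p - 1)) * indicator (F l) x)) \<partial>M)"
        by (simp only: mult_ac)
      finally show "choquet p M (u l) \<le> \<dots>" .
    qed auto
    also have "\<dots> = (\<integral>\<^sup>+x. ennreal (2 + w x powr (2 / p)) * \<psi> x \<partial>M)"
      unfolding \<psi>_def by (subst nn_integral_suminf[symmetric]) auto
    finally show "choquet p M (\<lambda>x. ennreal (y x * w x))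
        \<le> (\<integral>\<^sup>+x. ennreal (2 + w x powr (2 / p)) * \<psi> x \<partial>M)" .
  qed
qed

end

section \<open>Convexity and exponential moments over random signs\<close>

text \<open>The convex function y^N lies above its tangent at a. For a > 0 this is Bernoulli's
  inequality for y/a, multiplied by a^N.\<close>

lemma power_tangent_le:
  fixes a y :: real
  assumes "0 \<le> a" "0 \<le> y" "1 \<le> N"
  shows "real N * a ^ (N - 1) * y \<le> y ^ N + real (N - 1) * a ^ N"
proof (cases "a = 0")
  case True
  then show ?thesis using assms by (cases "N = 1") (auto simp: power_0_left)
next
  case False
  then have a: "0 < a" using assms by simp
  have "1 + real N * (y / a - 1) \<le> (1 + (y / a - 1)) ^ N"
    using a assms by (intro Bernoulli_inequality) auto
  then have "a ^ N * (1 + real N * (y / a - 1)) \<le> a ^ N * (y / a) ^ N"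
    using a by (intro mult_left_mono) auto
  also have "\<dots> = y ^ N" using a by (simp add: power_divide)
  finally have "a ^ N * (1 + real N * (y / a - 1)) \<le> y ^ N" .
  moreover have aN: "a ^ N = a * a ^ (N - 1)" using assms by (simp add: power_eq_if)
  moreover have "a * b * (1 + real N * (y / a - 1)) = a * b + real N * b * y - real N * (a * b)" for b
    using a by (simp add: field_simps)
  moreover have "real (N - 1) * a ^ N = real N * a ^ N - a ^ N"
    using assms by (simp add: of_nat_diff algebra_simps)
  ultimately show ?thesis by simp
qed

text \<open>If the left-hand integral is infinite, then \<open>enn2real\<close> makes the assertion trivial.\<close>

lemma nn_integral_jensen_power:
  fixes g :: "'a \<Rightarrow> real"
  assumes [measurable]: "g \<in> borel_measurable M" "\<psi> \<in> borel_measurable M"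
    and g0: "\<And>x. 0 \<le> g x" and A: "(\<integral>\<^sup>+x. \<psi> x \<partial>M) \<le> ennreal A" "0 < A"
    and z: "z \<le> (\<integral>\<^sup>+x. ennreal (g x) * \<psi> x \<partial>M)" and N: "1 \<le> N"
  shows "ennreal ((enn2real z / A) ^ N * A) \<le> (\<integral>\<^sup>+x. ennreal (g x ^ N) * \<psi> x \<partial>M)"
proof (cases "z = \<infinity> \<or> (\<integral>\<^sup>+x. ennreal (g x ^ N) * \<psi> x \<partial>M) = \<infinity>")
  case True
  then show ?thesis using N by (auto simp: power_0_left)
next
  case False
  then obtain r j where r: "z = ennreal r" "0 \<le> r"
    and j: "(\<integral>\<^sup>+x. ennreal (g x ^ N) * \<psi> x \<partial>M) = ennreal j" "0 \<le> j"
    by (cases z; cases "\<integral>\<^sup>+x. ennreal (g x ^ N) * \<psi> x \<partial>M") auto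
  \<comment> \<open>The tangent point is the value that stands for the \<psi>-mean of g. Integrating
    the tangent inequality and using r = a A lets N - 1 of the N copies of a^N A cancel.\<close>
  define a where "a = r / A"
  have a: "0 \<le> a" using r A by (simp add: a_def)
  have "ennreal (real N * a ^ (N - 1)) * z
      \<le> ennreal (real N * a ^ (N - 1)) * (\<integral>\<^sup>+x. ennreal (g x) * \<psi> x \<partial>M)"
    by (intro mult_left_mono z) auto
  also have "\<dots> = (\<integral>\<^sup>+x. ennreal (real N * a ^ (N - 1) * g x) * \<psi> x \<partial>M)"
    using a g0 by (subst nn_integral_cmult[symmetric]) (auto simp: ennreal_mult mult_ac)
  also have "\<dots> \<le> (\<integral>\<^sup>+x. ennreal (g x ^ N) * \<psi> x + ennreal (real (N - 1) * a ^ N) * \<psi> x \<partial>M)"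
  proof (rule nn_integral_mono)
    fix x
    have "ennreal (real N * a ^ (N - 1) * g x) \<le> ennreal (g x ^ N + real (N - 1) * a ^ N)"
      using a g0 N by (intro ennreal_leI power_tangent_le) auto
    also have "\<dots> = ennreal (g x ^ N) + ennreal (real (N - 1) * a ^ N)"
      using a g0 by (intro ennreal_plus) auto
    finally show "ennreal (real N * a ^ (N - 1) * g x) * \<psi> x
        \<le> ennreal (g x ^ N) * \<psi> x + ennreal (real (N - 1) * a ^ N) * \<psi> x"
      by (metis distrib_right mult_right_mono zero_le)
  qed
  also have "\<dots> = ennreal j + ennreal (real (N - 1) * a ^ N) * (\<integral>\<^sup>+x. \<psi> x \<partial>M)"
    by (simp add: nn_integral_add nn_integral_cmult j)
  also have "\<dots> \<le> ennreal j + ennreal (real (N - 1) * a ^ N) * ennreal A"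
    by (intro add_left_mono mult_left_mono A) auto
  finally have "ennreal (real N * a ^ (N - 1) * r) \<le> ennreal (j + real (N - 1) * a ^ N * A)"
    using a r j A by (simp add: ennreal_mult[symmetric] ennreal_plus[symmetric] del: ennreal_plus)
  then have "real N * a ^ (N - 1) * r \<le> j + real (N - 1) * a ^ N * A"
    by (rule ennreal_le_iff[THEN iffD1, rotated]) (use a j A in auto)
  moreover have "a ^ (N - 1) * r = a ^ N * A"
  proof -
    obtain m where "N = Suc m" using N by (cases N) auto
    then show ?thesis using A by (simp add: a_def)
  qed
  ultimately have "real N * (a ^ N * A) \<le> j + real (N - 1) * (a ^ N * A)"
    by (simp only: mult.assoc)
  also have "real (N - 1) * (a ^ N * A) = real N * (a ^ N * A) - a ^ N * A"
    using N by (simp add: of_nat_diff left_diff_distrib)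
  finally have "a ^ N * A \<le> j" by linarith
  then show ?thesis using r by (simp add: j a_def ennreal_leI)
qed

text \<open>On the nonnegative half-line, cosh y exp(-y^2/2) has a derivative with the sign of sinh
  y - y cosh y, which is nonpositive; it therefore stays below its value 1 at 0. Evenness covers
  negative x.\<close>

lemma cosh_le_exp_square:
  fixes x :: real
  shows "cosh x \<le> exp (x\<^sup>2 / 2)"
proof -
  have *: "cosh x \<le> exp (x\<^sup>2 / 2)" if "0 \<le> x" for x :: real
  proof -
    have sinh_le: "sinh y \<le> y * cosh y" if "0 \<le> y" for y :: real
    proof -
      have "(\<lambda>y. y * cosh y - sinh y) 0 \<le> (\<lambda>y. y * cosh y - sinh y) y"
      proof (rule DERIV_nonneg_imp_nondecreasing[OF that])
        fix u :: real assume "0 \<le> u"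
        then show "\<exists>z. ((\<lambda>y. y * cosh y - sinh y) has_real_derivative z) (at u) \<and> 0 \<le> z"
          by (intro exI[of _ "u * sinh u"]) (auto intro!: derivative_eq_intros)
      qed
      then show ?thesis by simp
    qed
    have "(\<lambda>y. cosh y * exp (- (y\<^sup>2 / 2))) x \<le> (\<lambda>y. cosh y * exp (- (y\<^sup>2 / 2))) 0"
    proof (rule DERIV_nonpos_imp_nonincreasing[OF that])
      fix u :: real assume "0 \<le> u"
      then show "\<exists>z. ((\<lambda>y. cosh y * exp (- (y\<^sup>2 / 2))) has_real_derivative z) (at u) \<and> z \<le> 0"
        using sinh_le[of u]
        by (intro exI[of _ "(sinh u - u * cosh u) * exp (- (u\<^sup>2 / 2))"] conjI)
          (auto intro!: derivative_eq_intros mult_nonpos_nonneg simp: algebra_simps)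
    qed
    then show ?thesis by (simp add: exp_minus field_simps)
  qed
  show ?thesis
    using *[of x] *[of "- x"] by (cases "0 \<le> x") auto
qed

lemma card_signs: "card (signs n) = 2 ^ n"
  by (simp add: signs_def card_PiE numeral_2_eq_2)

text \<open>Independence of the signs factorizes the exponential moment into a product of terms 2
  cosh (c a_k), each of which is bounded by a Gaussian exponential.\<close>

lemma sum_signs_exp_le:
  fixes a :: "nat \<Rightarrow> real"
  assumes "(\<Sum>k=1..n. (a k)\<^sup>2) \<le> 1"
  shows "(\<Sum>\<epsilon>\<in>signs n. exp (c * (\<Sum>k=1..n. \<epsilon> k * a k))) \<le> 2 ^ n * exp (c\<^sup>2 / 2)"
proof -
  have "(\<Sum>\<epsilon>\<in>signs n. exp (c * (\<Sum>k=1..n. \<epsilon> k * a k)))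
      = (\<Sum>\<epsilon>\<in>signs n. \<Prod>k=1..n. exp (c * (\<epsilon> k * a k)))"
    by (simp add: sum_distrib_left exp_sum)
  also have "\<dots> = (\<Prod>k=1..n. \<Sum>s\<in>{-1, 1}. exp (c * (s * a k)))"
    unfolding signs_def by (rule prod_sum_PiE[symmetric]) auto
  also have "\<dots> = (\<Prod>k=1..n. 2 * cosh (c * a k))"
    by (intro prod.cong) (auto simp: cosh_def)
  also have "\<dots> \<le> (\<Prod>k=1..n. 2 * exp ((c * a k)\<^sup>2 / 2))"
    by (intro prod_mono conjI mult_left_mono cosh_le_exp_square) auto
  also have "\<dots> = 2 ^ n * exp (c\<^sup>2 / 2 * (\<Sum>k=1..n. (a k)\<^sup>2))"
    by (simp add: prod.distrib exp_sum[symmetric] sum_distrib_left power_mult_distrib)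
  also have "\<dots> \<le> 2 ^ n * exp (c\<^sup>2 / 2 * 1)"
  proof -
    have "c\<^sup>2 / 2 * (\<Sum>k=1..n. (a k)\<^sup>2) \<le> c\<^sup>2 / 2 * 1"
      using assms by (intro mult_left_mono) auto
    then show ?thesis by simp
  qed
  finally show ?thesis by simp
qed

text \<open>The norm is at most the sum of the D absolute coordinates, so some coordinate is at
  least 1/D of it. Exponentials of plus and minus D times each coordinate then dominate, and the
  scalar bound applies with c = D and c = -D.\<close>

lemma sum_signs_exp_norm_le:
  fixes v :: "nat \<Rightarrow> 'a::euclidean_space"
  assumes "(\<Sum>k=1..n. (norm (v k))\<^sup>2) \<le> 1"
  defines "D \<equiv> real DIM('a)"
  shows "(\<Sum>\<epsilon>\<in>signs n. exp (norm (\<Sum>k=1..n. \<epsilon> k *\<^sub>R v k))) \<le> 2 ^ n * (2 * D * exp (D\<^sup>2 / 2))"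
proof -
  define T where "T \<epsilon> b = (\<Sum>k=1..n. \<epsilon> k * (v k \<bullet> b))" for \<epsilon> b
  have D: "0 < D" by (simp add: D_def)
  have "exp (norm (\<Sum>k=1..n. \<epsilon> k *\<^sub>R v k)) \<le> (\<Sum>b\<in>Basis. exp (D * T \<epsilon> b) + exp (- D * T \<epsilon> b))" for \<epsilon>
  proof -
    let ?y = "\<Sum>k=1..n. \<epsilon> k *\<^sub>R v k"
    have inner: "?y \<bullet> b = T \<epsilon> b" for b by (simp add: T_def inner_sum_left)
    have "\<exists>b\<in>Basis. norm ?y \<le> D * \<bar>?y \<bullet> b\<bar>"
    proof (rule ccontr)
      assume "\<not> ?thesis"
      then have "\<bar>?y \<bullet> b\<bar> < norm ?y / D" if "b \<in> Basis" for b
        using that D by (auto simp: field_simps not_le)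
      then have "(\<Sum>b\<in>Basis. \<bar>?y \<bullet> b\<bar>) < (\<Sum>b\<in>(Basis :: 'a set). norm ?y / D)"
        by (intro sum_strict_mono) auto
      also have "\<dots> = norm ?y" using D by (simp add: D_def)
      finally show False using norm_le_l1[of ?y] by simp
    qed
    then obtain b where b: "b \<in> Basis" "norm ?y \<le> D * \<bar>T \<epsilon> b\<bar>" unfolding inner by blast
    have "exp (norm ?y) \<le> exp (D * \<bar>T \<epsilon> b\<bar>)" using b by simp
    also have "\<dots> \<le> exp (D * T \<epsilon> b) + exp (- D * T \<epsilon> b)" by (cases "0 \<le> T \<epsilon> b") auto
    also have "\<dots> \<le> (\<Sum>b\<in>Basis. exp (D * T \<epsilon> b) + exp (- D * T \<epsilon> b))"
      using b by (intro member_le_sum[of b Basis "\<lambda>b. exp (D * T \<epsilon> b) + exp (- D * T \<epsilon> b)"]) auto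
    finally show ?thesis .
  qed
  then have "(\<Sum>\<epsilon>\<in>signs n. exp (norm (\<Sum>k=1..n. \<epsilon> k *\<^sub>R v k)))
      \<le> (\<Sum>\<epsilon>\<in>signs n. \<Sum>b\<in>Basis. exp (D * T \<epsilon> b) + exp (- D * T \<epsilon> b))"
    by (intro sum_mono)
  also have "\<dots> = (\<Sum>b\<in>Basis. (\<Sum>\<epsilon>\<in>signs n. exp (D * T \<epsilon> b)) + (\<Sum>\<epsilon>\<in>signs n. exp (- D * T \<epsilon> b)))"
    by (subst sum.swap) (simp add: sum.distrib)
  also have "\<dots> \<le> (\<Sum>b\<in>(Basis :: 'a set). 2 ^ n * exp (D\<^sup>2 / 2) + 2 ^ n * exp ((- D)\<^sup>2 / 2))"
  proof (intro sum_mono add_mono)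
    fix b :: 'a assume b: "b \<in> Basis"
    have "(\<Sum>k=1..n. (v k \<bullet> b)\<^sup>2) \<le> (\<Sum>k=1..n. (norm (v k))\<^sup>2)"
      using Basis_le_norm[OF b] by (intro sum_mono) (metis abs_ge_zero power2_abs power_mono)
    then have 1: "(\<Sum>k=1..n. (v k \<bullet> b)\<^sup>2) \<le> 1" using assms by simp
    show "(\<Sum>\<epsilon>\<in>signs n. exp (D * T \<epsilon> b)) \<le> 2 ^ n * exp (D\<^sup>2 / 2)"
      "(\<Sum>\<epsilon>\<in>signs n. exp (- D * T \<epsilon> b)) \<le> 2 ^ n * exp ((- D)\<^sup>2 / 2)"
      unfolding T_def using 1 by (intro sum_signs_exp_le; simp)+
  qed
  also have "\<dots> = 2 ^ n * (2 * D * exp (D\<^sup>2 / 2))" by (simp add: D_def)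
  finally show ?thesis .
qed

text \<open>The estimate 1 + w <= m (1 + w/m) <= m exp(w/m) is raised to the power m.\<close>

lemma one_plus_power_le_exp:
  fixes w :: real
  assumes "0 \<le> w" "1 \<le> m"
  shows "(1 + w) ^ m \<le> real m ^ m * exp w"
proof -
  have "(1 + w) ^ m \<le> (real m * exp (w / real m)) ^ m"
  proof (rule power_mono)
    have "1 + w \<le> real m * (1 + w / real m)" using assms by (simp add: distrib_left)
    also have "\<dots> \<le> real m * exp (w / real m)" by (intro mult_left_mono exp_ge_add_one_self) auto
    finally show "1 + w \<le> real m * exp (w / real m)" .
  qed (use assms in auto)
  also have "\<dots> = real m ^ m * exp w"
    using assms by (simp add: power_mult_distrib exp_of_nat_mult[symmetric])
  finally show ?thesis .
qed

section \<open>Moments of the signed sums\<close>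

lemma borel_measurable_signed_sum:
  fixes fs :: "nat \<Rightarrow> real \<Rightarrow> 'a::{second_countable_topology, real_normed_vector}"
  assumes "\<And>k. 1 \<le> k \<Longrightarrow> fs k \<in> borel_measurable M"
  shows "signed_sum fs n \<epsilon> \<in> borel_measurable M"
  unfolding signed_sum_def[abs_def] using assms by auto

lemma borel_measurable_square_fun:
  fixes fs :: "nat \<Rightarrow> real \<Rightarrow> 'a::real_normed_vector"
  assumes "\<And>k. 1 \<le> k \<Longrightarrow> fs k \<in> borel_measurable M"
  shows "square_fun fs n \<in> borel_measurable M"
  unfolding square_fun_def[abs_def] using assms by auto

lemma square_fun_nonneg: "0 \<le> square_fun fs n x"
  by (simp add: square_fun_def sum_nonneg)

text \<open>At a fixed x, division by the square function normalizes the coefficient vectors to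
  total square norm at most 1. The polynomial in W is then dominated by an exponential, giving a
  bound independent of x and, up to the factor 2^n, of n.\<close>

lemma sum_signs_normalized_le:
  fixes fs :: "nat \<Rightarrow> real \<Rightarrow> 'a::euclidean_space"
  assumes N: "1 \<le> N"
  defines "D \<equiv> real DIM('a)"
  shows "(\<Sum>\<epsilon>\<in>signs n. (2 + (norm (signed_sum fs n \<epsilon> x) / square_fun fs n x) ^ 4) ^ N)
    \<le> 2 ^ n * (2 ^ N * real (4 * N) ^ (4 * N) * (2 * D * exp (D\<^sup>2 / 2)))"
proof -
  define S where "S = square_fun fs n x"
  have S0: "0 \<le> S" by (simp add: S_def square_fun_nonneg)
  define v where "v k = (1 / (S * sqrt (real k))) *\<^sub>R fs k x" for k
  have v: "signed_sum fs n \<epsilon> x /\<^sub>R S = (\<Sum>k=1..n. \<epsilon> k *\<^sub>R v k)" for \<epsilon>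
    by (simp add: signed_sum_def v_def scaleR_sum_right field_simps)
  have "(\<Sum>k=1..n. (norm (v k))\<^sup>2) \<le> 1"
  proof -
    have "(\<Sum>k=1..n. (norm (v k))\<^sup>2) = (\<Sum>k=1..n. (norm (fs k x))\<^sup>2 / real k / S\<^sup>2)"
      by (intro sum.cong) (auto simp: v_def power_mult_distrib power_divide field_simps)
    also have "\<dots> = (\<Sum>k=1..n. (norm (fs k x))\<^sup>2 / real k) / S\<^sup>2" by (rule sum_divide_distrib[symmetric])
    also have "\<dots> = S\<^sup>2 / S\<^sup>2" by (simp add: S_def square_fun_def sum_nonneg)
    \<comment> \<open>If S = 0, division by zero gives 0 and the inequality persists; otherwise the
      quotient is 1.\<close>
    also have "\<dots> \<le> 1" by simp
    finally show ?thesis .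
  qed
  note exp_le = sum_signs_exp_norm_le[OF this, folded D_def]
  have "(2 + w ^ 4) ^ N \<le> 2 ^ N * real (4 * N) ^ (4 * N) * exp w" if "0 \<le> w" for w :: real
  proof -
    have "1 + w ^ 4 \<le> (1 + w) ^ 4"
    proof -
      have "(1 + w) ^ 4 = 1 + w ^ 4 + (4 * w + 6 * w\<^sup>2 + 4 * w ^ 3)"
        by (simp add: power2_eq_square power3_eq_cube power4_eq_xxxx algebra_simps)
      then show ?thesis using that by simp
    qed
    moreover have "0 \<le> w ^ 4" using that by simp
    ultimately have "2 + w ^ 4 \<le> 2 * (1 + w) ^ 4" by linarith
    then have "(2 + w ^ 4) ^ N \<le> (2 * (1 + w) ^ 4) ^ N" by (intro power_mono) auto
    also have "\<dots> = 2 ^ N * (1 + w) ^ (4 * N)" by (simp add: power_mult_distrib power_mult)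
    also have "\<dots> \<le> 2 ^ N * (real (4 * N) ^ (4 * N) * exp w)"
      using that N by (intro mult_left_mono one_plus_power_le_exp) auto
    finally show ?thesis by (simp add: mult.assoc)
  qed
  then have "(\<Sum>\<epsilon>\<in>signs n. (2 + (norm (signed_sum fs n \<epsilon> x) / S) ^ 4) ^ N)
      \<le> (\<Sum>\<epsilon>\<in>signs n. 2 ^ N * real (4 * N) ^ (4 * N) * exp (norm (signed_sum fs n \<epsilon> x) / S))"
    using S0 by (intro sum_mono) auto
  also have "\<dots> = 2 ^ N * real (4 * N) ^ (4 * N) * (\<Sum>\<epsilon>\<in>signs n. exp (norm (\<Sum>k=1..n. \<epsilon> k *\<^sub>R v k)))"
    using S0 unfolding v[symmetric] by (simp add: sum_distrib_left divide_inverse_commute)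
  also have "\<dots> \<le> 2 ^ N * real (4 * N) ^ (4 * N) * (2 ^ n * (2 * D * exp (D\<^sup>2 / 2)))"
    by (intro mult_left_mono exp_le) auto
  finally show ?thesis by (simp add: S_def mult_ac)
qed

text \<open>Needed where the square function vanishes: there the quotient W is 0 by convention, and
  the factorization of the signed sum remains valid.\<close>

lemma norm_signed_sum_eq_0:
  assumes "square_fun fs n x = 0"
  shows "signed_sum fs n \<epsilon> x = 0"
proof -
  have "fs k x = 0" if "k \<in> {1..n}" for k
    using assms that by (auto simp: square_fun_def sum_nonneg_eq_0_iff)
  then show ?thesis by (simp add: signed_sum_def)
qed

text \<open>The weight \<psi> depends only on the square function, so one weight serves all signs.
  After Jensen's inequality the sum over signs moves inside the integral, where the pointwise moment
  bound applies.\<close>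

lemma Ave_choquet_signed_sum_le:
  fixes fs :: "nat \<Rightarrow> real \<Rightarrow> 'a::euclidean_space"
  assumes fs: "\<And>k. 1 \<le> k \<Longrightarrow> fs k \<in> borel_measurable unit_leb" and q: "0 < q" "q \<le> 1"
    and fin: "choquet (q / 2) unit_leb (\<lambda>x. ennreal (square_fun fs n x powr q)) < \<infinity>"
    and s: "0 < s" "s \<le> real N" and N: "1 \<le> N"
  defines "D \<equiv> real DIM('a)"
  shows "Ave n (\<lambda>\<epsilon>. enn2real (choquet (q / 2) unit_leb
        (\<lambda>x. ennreal (norm (signed_sum fs n \<epsilon> x) powr q))) powr s)
    \<le> (1 + 2 ^ N * real (4 * N) ^ (4 * N) * (2 * D * exp (D\<^sup>2 / 2)))
      * (1 + 4 * enn2real (choquet (q / 2) unit_leb (\<lambda>x. ennreal (square_fun fs n x powr q)))) powr s"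
proof -
  define K where "K = 2 ^ N * real (4 * N) ^ (4 * N) * (2 * D * exp (D\<^sup>2 / 2))"
  define Z where "Z \<epsilon> = choquet (q / 2) unit_leb (\<lambda>x. ennreal (norm (signed_sum fs n \<epsilon> x) powr q))" for \<epsilon>
  define C where "C = choquet (q / 2) unit_leb (\<lambda>x. ennreal (square_fun fs n x powr q))"
  define A where "A = 1 + 4 * enn2real C"
  have A: "0 < A" by (simp add: A_def add_pos_nonneg)
  note [measurable] = borel_measurable_signed_sum[OF fs] borel_measurable_square_fun[OF fs]
  define y where "y x = square_fun fs n x powr q" for x
  define W where "W \<epsilon> x = norm (signed_sum fs n \<epsilon> x) / square_fun fs n x" for \<epsilon> x
  have W0: "0 \<le> W \<epsilon> x" for \<epsilon> x by (simp add: W_def square_fun_nonneg)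
  have [measurable]: "W \<epsilon> \<in> borel_measurable unit_leb" for \<epsilon> unfolding W_def by measurable
  have yW: "norm (signed_sum fs n \<epsilon> x) powr q = y x * W \<epsilon> x powr q" for \<epsilon> x
    using square_fun_nonneg[of fs n x] norm_signed_sum_eq_0[of fs n x \<epsilon>] q
    by (cases "square_fun fs n x = 0") (auto simp: y_def W_def powr_divide)
  have "y \<in> borel_measurable unit_leb" unfolding y_def by measurable
  then obtain \<psi> where \<psi> [measurable]: "\<psi> \<in> borel_measurable unit_leb"
    and int_\<psi>: "(\<integral>\<^sup>+x. \<psi> x \<partial>unit_leb) \<le> 1 + 4 * choquet (q / 2) unit_leb (\<lambda>x. ennreal (y x))"
    and \<psi>_le: "\<And>w. w \<in> borel_measurable unit_leb \<Longrightarrow> (\<And>x. 0 \<le> w x) \<Longrightarrow>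
      choquet (q / 2) unit_leb (\<lambda>x. ennreal (y x * w x))
        \<le> (\<integral>\<^sup>+x. ennreal (2 + w x powr (2 / (q / 2))) * \<psi> x \<partial>unit_leb)"
    by (rule unit_leb.choquet_mult_weight[of y "q / 2"])
      (use q measure_unit_leb_space in \<open>auto simp: space_restrict_space\<close>)
  have int_A: "(\<integral>\<^sup>+x. \<psi> x \<partial>unit_leb) \<le> ennreal A"
  proof -
    have "C = ennreal (enn2real C)" using fin by (simp add: C_def)
    then have "1 + 4 * C = ennreal A"
      by (metis A_def ennreal_1 ennreal_mult ennreal_numeral ennreal_plus enn2real_nonneg
          mult_nonneg_nonneg zero_le_numeral zero_le_one)
    then show ?thesis using int_\<psi> by (simp add: C_def y_def)
  qed
  have "ennreal ((enn2real (Z \<epsilon>) / A) ^ N * A) \<le> (\<integral>\<^sup>+x. ennreal ((2 + W \<epsilon> x ^ 4) ^ N) * \<psi> x \<partial>unit_leb)" for \<epsilon>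
  proof (rule nn_integral_jensen_power[OF _ _ _ int_A A _ N])
    have "Z \<epsilon> \<le> (\<integral>\<^sup>+x. ennreal (2 + (W \<epsilon> x powr q) powr (2 / (q / 2))) * \<psi> x \<partial>unit_leb)"
      unfolding Z_def yW by (intro \<psi>_le) auto
    moreover have "(W \<epsilon> x powr q) powr (2 / (q / 2)) = W \<epsilon> x ^ 4" for x
      using q W0[of \<epsilon> x] by (cases "W \<epsilon> x = 0") (simp_all add: powr_powr)
    ultimately show "Z \<epsilon> \<le> (\<integral>\<^sup>+x. ennreal (2 + W \<epsilon> x ^ 4) * \<psi> x \<partial>unit_leb)" by simp
  qed (auto simp: W0 intro!: add_nonneg_nonneg)
  then have "(\<Sum>\<epsilon>\<in>signs n. ennreal ((enn2real (Z \<epsilon>) / A) ^ N * A))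
      \<le> (\<Sum>\<epsilon>\<in>signs n. \<integral>\<^sup>+x. ennreal ((2 + W \<epsilon> x ^ 4) ^ N) * \<psi> x \<partial>unit_leb)"
    by (rule sum_mono)
  also have "\<dots> = (\<integral>\<^sup>+x. ennreal (\<Sum>\<epsilon>\<in>signs n. (2 + W \<epsilon> x ^ 4) ^ N) * \<psi> x \<partial>unit_leb)"
    by (subst nn_integral_sum[symmetric]) (auto simp: sum_distrib_right[symmetric] W0 add_nonneg_nonneg)
  also have "\<dots> \<le> (\<integral>\<^sup>+x. ennreal (2 ^ n * K) * \<psi> x \<partial>unit_leb)"
    unfolding W_def K_def D_def
    by (intro nn_integral_mono mult_right_mono ennreal_leI sum_signs_normalized_le N) auto
  also have "\<dots> = ennreal (2 ^ n * K) * (\<integral>\<^sup>+x. \<psi> x \<partial>unit_leb)"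
    by (rule nn_integral_cmult) auto
  also have "\<dots> \<le> ennreal (2 ^ n * K) * ennreal A" by (intro mult_left_mono int_A) auto
  also have "\<dots> = ennreal (2 ^ n * K * A)" using A by (simp add: ennreal_mult'')
  also have "(\<Sum>\<epsilon>\<in>signs n. ennreal ((enn2real (Z \<epsilon>) / A) ^ N * A))
      = ennreal ((\<Sum>\<epsilon>\<in>signs n. (enn2real (Z \<epsilon>) / A) ^ N) * A)"
    using A by (simp add: sum_distrib_right)
  finally have "(\<Sum>\<epsilon>\<in>signs n. (enn2real (Z \<epsilon>) / A) ^ N) * A \<le> 2 ^ n * K * A"
    by (rule ennreal_le_iff[THEN iffD1, rotated]) (use A in \<open>auto simp: K_def D_def\<close>)
  then have sum_le: "(\<Sum>\<epsilon>\<in>signs n. (enn2real (Z \<epsilon>) / A) ^ N) \<le> 2 ^ n * K" using A by simp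
  \<comment> \<open>A real exponent s <= N is reduced to the integer N: for a normalized value u the
    power u^s is at most 1 when u <= 1 and at most u^N otherwise.\<close>
  have "enn2real (Z \<epsilon>) powr s \<le> A powr s * (1 + (enn2real (Z \<epsilon>) / A) ^ N)" for \<epsilon>
  proof -
    let ?u = "enn2real (Z \<epsilon>) / A"
    have u: "0 \<le> ?u" using A by simp
    have "?u powr s \<le> 1 + ?u ^ N"
    proof (cases "?u \<le> 1")
      case True
      then have "?u powr s \<le> 1" using u s by (intro powr_le1) auto
      moreover have "0 \<le> ?u ^ N" using u by simp
      ultimately show ?thesis by linarith
    next
      case False
      then have "?u powr s \<le> ?u powr real N" using s by (intro powr_mono) auto
      then show ?thesis using False by (simp add: powr_realpow)
    qed
    then have "A powr s * ?u powr s \<le> A powr s * (1 + ?u ^ N)" by (intro mult_left_mono) auto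
    then show ?thesis using A by (simp add: powr_divide)
  qed
  then have "(\<Sum>\<epsilon>\<in>signs n. enn2real (Z \<epsilon>) powr s)
      \<le> (\<Sum>\<epsilon>\<in>signs n. A powr s * (1 + (enn2real (Z \<epsilon>) / A) ^ N))"
    by (rule sum_mono)
  also have "\<dots> = A powr s * (2 ^ n + (\<Sum>\<epsilon>\<in>signs n. (enn2real (Z \<epsilon>) / A) ^ N))"
    by (simp add: sum_distrib_left[symmetric] sum.distrib card_signs)
  also have "\<dots> \<le> A powr s * (2 ^ n + 2 ^ n * K)"
    using sum_le by (intro mult_left_mono) auto
  finally have "Ave n (\<lambda>\<epsilon>. enn2real (Z \<epsilon>) powr s) \<le> (1 + K) * A powr s"
    by (simp add: Ave_def divide_le_eq algebra_simps)
  then show ?thesis by (simp only: Z_def K_def A_def C_def)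
qed

section \<open>Return to the Lorentz space and the two asymptotic estimates\<close>

lemma lorentz2_iff_choquet:
  fixes f :: "real \<Rightarrow> 'a::real_normed_vector"
  assumes "f \<in> borel_measurable unit_leb" and "0 < q"
  shows "f \<in> lorentz2 q \<longleftrightarrow> choquet (q / 2) unit_leb (\<lambda>x. ennreal (norm (f x) powr q)) < \<infinity>"
  using assms by (auto simp: lorentz2_def lorentz2_integral_eq_choquet ennreal_mult_less_top)

lemma lorentz2_norm_eq_choquet:
  fixes f :: "real \<Rightarrow> 'a::real_normed_vector"
  assumes "f \<in> borel_measurable unit_leb" and "0 < q"
  shows "lorentz2_norm q f
    = (2 / q * enn2real (choquet (q / 2) unit_leb (\<lambda>x. ennreal (norm (f x) powr q)))) powr (1 / q)"
  using assms by (simp add: lorentz2_norm_def lorentz2_integral_eq_choquet enn2real_mult)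

text \<open>The coefficients have absolute value at most 1 and q <= 1, so the q-th power of the norm
  of the signed sum is at most the sum of those of the \<open>fs k\<close>; subadditivity of the
  Choquet integral then yields finiteness.\<close>

lemma signed_sum_in_lorentz2:
  fixes fs :: "nat \<Rightarrow> real \<Rightarrow> 'a::euclidean_space"
  assumes q: "0 < q" "q \<le> 1" and fs: "\<And>k. 1 \<le> k \<Longrightarrow> fs k \<in> lorentz2 q" and \<epsilon>: "\<epsilon> \<in> signs n"
  shows "signed_sum fs n \<epsilon> \<in> lorentz2 q"
proof -
  have meas: "fs k \<in> borel_measurable unit_leb" if "1 \<le> k" for k
    using fs[OF that] by (simp add: lorentz2_def)
  note [measurable] = borel_measurable_signed_sum[OF meas]
  define w where "w k x = (if k \<in> {1..n} then ennreal (norm (fs k x) powr q) else ennreal 0)" for k x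
  have [measurable]: "w k \<in> borel_measurable unit_leb" for k
    unfolding w_def using meas[of k] by (cases "k \<in> {1..n}") auto
  have "choquet (q / 2) unit_leb (\<lambda>x. ennreal (norm (signed_sum fs n \<epsilon> x) powr q))
      \<le> (\<Sum>k. choquet (q / 2) unit_leb (w k))"
  proof (rule unit_leb.choquet_suminf)
    fix x
    have "norm (signed_sum fs n \<epsilon> x) \<le> (\<Sum>k=1..n. norm (fs k x))"
      unfolding signed_sum_def
    proof (rule sum_norm_le)
      fix k assume k: "k \<in> {1..n}"
      then have "\<epsilon> k \<in> {-1, 1}" using \<epsilon> by (auto simp: signs_def)
      then have "\<bar>\<epsilon> k / sqrt (real k)\<bar> \<le> 1" using k by (auto simp: divide_le_eq)
      then show "norm ((\<epsilon> k / sqrt (real k)) *\<^sub>R fs k x) \<le> norm (fs k x)"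
        by (simp add: mult_left_le_one_le del: abs_divide)
    qed
    then have "norm (signed_sum fs n \<epsilon> x) powr q \<le> (\<Sum>k=1..n. norm (fs k x)) powr q"
      using q by (intro powr_mono2) auto
    also have "\<dots> \<le> (\<Sum>k=1..n. norm (fs k x) powr q)"
      using q by (intro powr_sum_le) auto
    finally have "ennreal (norm (signed_sum fs n \<epsilon> x) powr q) \<le> ennreal (\<Sum>k=1..n. norm (fs k x) powr q)"
      by (rule ennreal_leI)
    also have "\<dots> = (\<Sum>k=1..n. w k x)" by (simp add: w_def)
    also have "\<dots> \<le> (\<Sum>k. w k x)" by (rule sum_le_suminf) auto
    finally show "ennreal (norm (signed_sum fs n \<epsilon> x) powr q) \<le> (\<Sum>k. w k x)" .
  qed (use q in auto)
  also have "\<dots> = (\<Sum>k=1..n. choquet (q / 2) unit_leb (w k))"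
    using q by (intro suminf_finite) (auto simp: w_def[abs_def] unit_leb.choquet_const simp del: ennreal_0)
  also have "\<dots> < \<infinity>"
  proof -
    have "choquet (q / 2) unit_leb (w k) < \<infinity>" if "k \<in> {1..n}" for k
    proof -
      have "w k = (\<lambda>x. ennreal (norm (fs k x) powr q))" using that by (simp add: w_def[abs_def])
      then show ?thesis
        using that fs[of k] lorentz2_iff_choquet[OF meas[of k] q(1)] by simp
    qed
    then show ?thesis by (simp add: less_top)
  qed
  finally show ?thesis using q by (simp add: lorentz2_iff_choquet)
qed

(* The class constraint on 'a is satisfied by the real and the complex numbers, the two scalar
   fields.  The membership clauses assert that the norms occurring in the estimates are finite. *)
theorem theorem6p9:
  fixes q :: real
    and f :: "real \<Rightarrow> 'a::{real_normed_field, euclidean_space}"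
    and fs :: "nat \<Rightarrow> real \<Rightarrow> 'a"
  assumes "0 < q" and "q \<le> 1"
    and "f \<in> lorentz2 q"
    and "\<And>k. k \<ge> 1 \<Longrightarrow> fs k \<in> lorentz2 q"
    and "\<And>k t. k \<ge> 1 \<Longrightarrow> t > 0 \<Longrightarrow> decr_rearr (fs k) t \<le> decr_rearr f t"
  shows "(\<forall>n. square_fun fs n \<in> lorentz2 q) \<and>
    (\<lambda>n. lorentz2_norm q (square_fun fs n)) \<in> o(\<lambda>n. (harm n :: real) powr (1/q)) \<and>
    (\<forall>n. \<forall>\<epsilon>\<in>signs n. signed_sum fs n \<epsilon> \<in> lorentz2 q) \<and>
    (\<forall>r > max 2 q.
      (\<lambda>n. Ave n (\<lambda>\<epsilon>. lorentz2_norm q (signed_sum fs n \<epsilon>) powr r) powr (1/r))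
        \<in> o(\<lambda>n. (harm n :: real) powr (1/q)))"
proof -
  note q = assms(1,2)
  have meas: "fs k \<in> borel_measurable unit_leb" if "1 \<le> k" for k
    using assms(4)[OF that] by (simp add: lorentz2_def)
  note [measurable] = borel_measurable_signed_sum[OF meas] borel_measurable_square_fun[OF meas]
  define C where "C n = choquet (q / 2) unit_leb (\<lambda>x. ennreal (square_fun fs n x powr q))" for n
  have fin: "C n < \<infinity>" for n
    unfolding C_def by (rule lorentz2_choquet_square_fun(1)[OF assms])
  have small: "(\<lambda>n. enn2real (C n)) \<in> o(harm)"
    unfolding C_def by (rule lorentz2_choquet_square_fun(2)[OF assms])
  \<comment> \<open>The absolute value makes the statement fit \<open>smallo_powr\<close>; it is
    harmless here because only nonnegative sequences are inserted.\<close>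
  have root: "(\<lambda>n. \<bar>g n\<bar> powr (1/q)) \<in> o(\<lambda>n. (harm n :: real) powr (1/q))" if "g \<in> o(harm)" for g :: "nat \<Rightarrow> real"
    using smallo_powr[OF that, of "1/q"] q by simp
  have 1: "square_fun fs n \<in> lorentz2 q" for n
    using fin[of n] q by (simp add: lorentz2_iff_choquet C_def square_fun_nonneg)
  have 2: "(\<lambda>n. lorentz2_norm q (square_fun fs n)) \<in> o(\<lambda>n. (harm n :: real) powr (1/q))"
  proof -
    have "lorentz2_norm q (square_fun fs n) = \<bar>2 / q * enn2real (C n)\<bar> powr (1/q)" for n
      using q by (simp add: lorentz2_norm_eq_choquet C_def square_fun_nonneg)
    moreover have "(\<lambda>n. 2 / q * enn2real (C n)) \<in> o(harm)"
      using small q by (subst landau_o.small.cmult_in_iff) auto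
    ultimately show ?thesis by (simp only: root)
  qed
  have 3: "(\<lambda>n. Ave n (\<lambda>\<epsilon>. lorentz2_norm q (signed_sum fs n \<epsilon>) powr r) powr (1/r))
      \<in> o(\<lambda>n. (harm n :: real) powr (1/q))" if "max 2 q < r" for r
  proof -
    have r: "0 < r" using that by simp
    \<comment> \<open>The r-th power of the norm is the power r/q of the Choquet integral up to a
      constant; N is an integer above this exponent.\<close>
    define N where "N = nat \<lceil>r / q\<rceil>"
    have N: "1 \<le> N" "r / q \<le> real N" using r q by (auto simp: N_def less_ceiling_iff Suc_le_eq)
    define Z where "Z n \<epsilon> = enn2real (choquet (q / 2) unit_leb
        (\<lambda>x. ennreal (norm (signed_sum fs n \<epsilon> x) powr q)))" for n \<epsilon>
    define K where "K = 1 + 2 ^ N * real (4 * N) ^ (4 * N) * (2 * real DIM('a) * exp ((real DIM('a))\<^sup>2 / 2))"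
    define A where "A n = 1 + 4 * enn2real (C n)" for n
    have A: "0 < A n" for n by (simp add: A_def add_pos_nonneg)
    have K: "0 \<le> K" by (simp add: K_def)
    have Z0: "0 \<le> Z n \<epsilon>" for n \<epsilon> by (simp add: Z_def)
    have le: "Ave n (\<lambda>\<epsilon>. lorentz2_norm q (signed_sum fs n \<epsilon>) powr r) powr (1/r)
        \<le> ((2 / q) powr (r / q) * K) powr (1/r) * A n powr (1/q)" for n
    proof -
      have "Ave n (\<lambda>\<epsilon>. lorentz2_norm q (signed_sum fs n \<epsilon>) powr r)
          = Ave n (\<lambda>\<epsilon>. (2 / q) powr (r / q) * Z n \<epsilon> powr (r / q))"
      proof -
        have "lorentz2_norm q (signed_sum fs n \<epsilon>) powr r = (2 / q) powr (r / q) * Z n \<epsilon> powr (r / q)" for \<epsilon>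
        proof -
          have "lorentz2_norm q (signed_sum fs n \<epsilon>) = (2 / q * Z n \<epsilon>) powr (1 / q)"
            unfolding Z_def using q by (intro lorentz2_norm_eq_choquet) auto
          then have "lorentz2_norm q (signed_sum fs n \<epsilon>) powr r = (2 / q * Z n \<epsilon>) powr (r / q)"
            by (simp add: powr_powr)
          also have "\<dots> = (2 / q) powr (r / q) * Z n \<epsilon> powr (r / q)"
            by (rule powr_mult)
          finally show ?thesis .
        qed
        then show ?thesis by simp
      qed
      also have "\<dots> = (2 / q) powr (r / q) * Ave n (\<lambda>\<epsilon>. Z n \<epsilon> powr (r / q))"
        by (simp add: Ave_def sum_distrib_left)
      also have "\<dots> \<le> (2 / q) powr (r / q) * (K * A n powr (r / q))"
        unfolding Z_def K_def A_def C_def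
        using meas q fin[of n, unfolded C_def] r N
        by (intro mult_left_mono Ave_choquet_signed_sum_le) auto
      finally have "Ave n (\<lambda>\<epsilon>. lorentz2_norm q (signed_sum fs n \<epsilon>) powr r) powr (1/r)
          \<le> ((2 / q) powr (r / q) * K * A n powr (r / q)) powr (1/r)"
        using r by (intro powr_mono2) (auto simp: Ave_def mult.assoc intro!: divide_nonneg_nonneg sum_nonneg)
      also have "\<dots> = ((2 / q) powr (r / q) * K) powr (1/r) * A n powr (1/q)"
        using r A[of n] K by (simp add: powr_mult powr_powr)
      finally show ?thesis .
    qed
    have "A \<in> o(harm)"
    proof -
      \<comment> \<open>The additive 1 in \<open>A\<close> comes from the mass of the weight and is
        negligible because the harmonic series diverges.\<close>
      have "(\<lambda>_. 1) \<in> o(harm :: nat \<Rightarrow> real)"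
      proof (rule smalloI_tendsto)
        show "((\<lambda>n. 1 / harm n :: real) \<longlongrightarrow> 0) sequentially"
          using tendsto_inverse_0_at_top[OF harm_at_top] by (simp add: inverse_eq_divide)
        show "\<forall>\<^sub>F n in sequentially. harm n \<noteq> (0::real)"
          using eventually_gt_at_top[of 0]
        proof eventually_elim
          case (elim n)
          then show ?case using harm_pos[of n, where 'a=real] by linarith
        qed
      qed
      then show ?thesis unfolding A_def[abs_def] using small by (intro sum_in_smallo) auto
    qed
    then have "(\<lambda>n. \<bar>A n\<bar> powr (1/q)) \<in> o(\<lambda>n. (harm n :: real) powr (1/q))" by (rule root)
    moreover have "(\<lambda>n. Ave n (\<lambda>\<epsilon>. lorentz2_norm q (signed_sum fs n \<epsilon>) powr r) powr (1/r))
        \<in> O(\<lambda>n. \<bar>A n\<bar> powr (1/q))"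
      using le A by (intro bigoI[of _ "((2 / q) powr (r / q) * K) powr (1/r)"] always_eventually) (simp add: less_imp_le)
    ultimately show ?thesis by (rule landau_o.big_small_trans[rotated])
  qed
  have 4: "signed_sum fs n \<epsilon> \<in> lorentz2 q" if "\<epsilon> \<in> signs n" for n \<epsilon>
    using q assms(4) that by (rule signed_sum_in_lorentz2)
  show ?thesis using 1 2 3 4 by blast
qed

end
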